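(* Let $\Sigma$ be a finite set of tgds and egds over a schema $\mathbf R$, let $I$ be an instance, and let $\star\in\{\mathsf{std},\mathsf{obl},\mathsf{sobl},\mathsf{core}\}$. Let $\Sigma^{tgd}$ be the set of tgds obtained as follows, using a new binary relation symbol $E\notin\mathbf R$: (1) every tgd of $\Sigma$ is in $\Sigma^{tgd}$; (2) for each egd $\alpha\rightarrow x=y$ in $\Sigma$, the tgd $\alpha\rightarrow E(x,y),E(y,x)$ is in $\Sigma^{tgd}$; (3) for each relation symbol $R$ used in $\Sigma$ and each $1\le i\le\mathrm{arity}(R)$, the tgd $E(x,y),R(x_1,\dots,x_{i-1},x,x_{i+1},\dots,x_{\mathrm{arity}(R)})\rightarrow R(x_1,\dots,x_{i-1},y,x_{i+1},\dots,x_{\mathrm{arity}(R)})$ is in $\Sigma^{tgd}$. If the $\star$-chase on $I$ with $\Sigma^{tgd}$ terminates, then so does the $\star$-chase on $I$ with $\Sigma$.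
   Context: Instances are finite sets of atoms over constants ($\mathsf{Cons}$) and nulls ($\mathsf{Nulls}$). A tgd is $\forall\bar x\forall\bar y\,(\alpha(\bar x,\bar y)\rightarrow\exists\bar z\,\beta(\bar x,\bar z))$; an egd is $\forall\bar x\,(\alpha(\bar x)\rightarrow x=y)$ with $x,y$ in $\bar x$; $\alpha,\beta$ are conjunctions of atoms. A trigger is $(\xi,h)$ with $h$ a mapping on body variables (identity on constants) and $h(\alpha)\subseteq I$. For a tgd it is active if no extension $h'$ has $h'(\beta)\subseteq I$; firing it adds $h'(\beta)$ where $h'$ extends $h$ with fresh nulls for existential variables. For an egd it is active if $h(x)\ne h(y)$; firing it replaces, if both are nulls, all occurrences of the later null by the earlier one (in a fixed enumeration); if one is a null and the other a constant, all occurrences of the null by the constant; if both are constants, the chase fails. Chase variants: standard chase fires (nondeterministically) active triggers; oblivious chase fires any trigger but each trigger at most once; semi-oblivious chase fires any trigger but for each tgd at most one trigger among those whose mappings agree on the variables $\bar x$ shared by body and head; core chase applies active egd triggers, otherwise fires all active tgd triggers in parallel and replaces the union of the results by its core. A chase terminates when it reaches an instance where the respective variant admits no further step. *)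

theory Defs
  imports Main
begin

text \<open>Terms of instances: constants or labelled nulls; nulls are enumerated by nat
  (the fixed enumeration used by egd steps).\<close>
datatype 'c trm = Cst 'c | Nul nat

datatype 'c rtrm = RCst 'c | RVar nat

type_synonym ('r,'c) atom = "'r \<times> 'c trm list"
type_synonym ('r,'c) ratom = "'r \<times> 'c rtrm list"

text \<open>TGD body head  stands for  body \<rightarrow> \<exists>z. head;  EGD body x y  stands for body \<rightarrow> x = y.\<close>
datatype ('r,'c) dep =
    TGD "('r,'c) ratom list" "('r,'c) ratom list"
  | EGD "('r,'c) ratom list" nat nat

fun is_tgd :: "('r,'c) dep \<Rightarrow> bool" where
  "is_tgd (TGD _ _) = True" | "is_tgd (EGD _ _ _) = False"

fun body :: "('r,'c) dep \<Rightarrow> ('r,'c) ratom list" where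
  "body (TGD b _) = b" | "body (EGD b _ _) = b"

fun heads :: "('r,'c) dep \<Rightarrow> ('r,'c) ratom list" where
  "heads (TGD _ h) = h" | "heads (EGD _ _ _) = []"

fun rvars :: "'c rtrm \<Rightarrow> nat set" where
  "rvars (RVar v) = {v}" | "rvars (RCst _) = {}"

definition avars :: "('r,'c) ratom list \<Rightarrow> nat set" where
  "avars as = (\<Union>a\<in>set as. \<Union>t\<in>set (snd a). rvars t)"

definition bvars :: "('r,'c) dep \<Rightarrow> nat set" where
  "bvars \<xi> = avars (body \<xi>)"

definition evars :: "('r,'c) dep \<Rightarrow> nat set" where
  "evars \<xi> = avars (heads \<xi>) - avars (body \<xi>)"

text \<open>variables on which the semi-oblivious chase identifies triggers: the frontier
  (variables shared by body and head) for tgds; all body variables for egds.\<close>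
fun key_vars :: "('r,'c) dep \<Rightarrow> nat set" where
  "key_vars (TGD b h) = avars b \<inter> avars h"
| "key_vars (EGD b x y) = avars b"

fun inst_t :: "(nat \<Rightarrow> 'c trm) \<Rightarrow> 'c rtrm \<Rightarrow> 'c trm" where
  "inst_t h (RVar v) = h v" | "inst_t h (RCst c) = Cst c"

definition inst :: "(nat \<Rightarrow> 'c trm) \<Rightarrow> ('r,'c) ratom list \<Rightarrow> ('r,'c) atom set" where
  "inst h as = (\<lambda>(r,ts). (r, map (inst_t h) ts)) ` set as"

definition nulls_of :: "('r,'c) atom set \<Rightarrow> nat set" where
  "nulls_of I = {n. \<exists>a\<in>I. Nul n \<in> set (snd a)}"

definition rels_of :: "('r,'c) dep set \<Rightarrow> 'r set" where
  "rels_of \<Sigma> = {R. \<exists>\<xi>\<in>\<Sigma>. \<exists>ts. (R,ts) \<in> set (body \<xi>) \<union> set (heads \<xi>)}"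

definition is_trigger :: "('r,'c) atom set \<Rightarrow> ('r,'c) dep \<Rightarrow> (nat \<Rightarrow> 'c trm) \<Rightarrow> bool" where
  "is_trigger I \<xi> h \<longleftrightarrow> inst h (body \<xi>) \<subseteq> I"

fun active :: "('r,'c) atom set \<Rightarrow> ('r,'c) dep \<Rightarrow> (nat \<Rightarrow> 'c trm) \<Rightarrow> bool" where
  "active I (TGD b hs) h \<longleftrightarrow>
     \<not> (\<exists>h'. (\<forall>v\<in>avars b. h' v = h v) \<and> inst h' hs \<subseteq> I)"
| "active I (EGD b x y) h \<longleftrightarrow> h x \<noteq> h y"

definition fresh_ext :: "('r,'c) atom set \<Rightarrow> ('r,'c) dep \<Rightarrow> (nat \<Rightarrow> 'c trm) \<Rightarrow> (nat \<Rightarrow> 'c trm) \<Rightarrow> bool" where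
  "fresh_ext I \<xi> h h' \<longleftrightarrow> (\<forall>v\<in>bvars \<xi>. h' v = h v) \<and> inj_on h' (evars \<xi>)
      \<and> (\<forall>v\<in>evars \<xi>. \<exists>n. h' v = Nul n \<and> n \<notin> nulls_of I)"

definition restr :: "(nat \<Rightarrow> 'c trm) \<Rightarrow> nat set \<Rightarrow> nat \<Rightarrow> 'c trm option" where
  "restr h V = (\<lambda>v. if v \<in> V then Some (h v) else None)"

datatype ('r,'c) st = Fail | Inst "('r,'c) atom set"

definition replace :: "'c trm \<Rightarrow> 'c trm \<Rightarrow> ('r,'c) atom set \<Rightarrow> ('r,'c) atom set" where
  "replace s t I = (\<lambda>(r,ts). (r, map (\<lambda>u. if u = s then t else u) ts)) ` I"

fun egd_result :: "('r,'c) atom set \<Rightarrow> 'c trm \<Rightarrow> 'c trm \<Rightarrow> ('r,'c) st" where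
  "egd_result I (Nul m) (Nul n) = Inst (replace (Nul (max m n)) (Nul (min m n)) I)"
| "egd_result I (Nul n) (Cst c) = Inst (replace (Nul n) (Cst c) I)"
| "egd_result I (Cst c) (Nul n) = Inst (replace (Nul n) (Cst c) I)"
| "egd_result I (Cst c) (Cst d) = (if c = d then Inst I else Fail)"

fun fire :: "('r,'c) atom set \<Rightarrow> ('r,'c) dep \<Rightarrow> (nat \<Rightarrow> 'c trm) \<Rightarrow> ('r,'c) st \<Rightarrow> bool" where
  "fire I (TGD b hs) h S \<longleftrightarrow>
     (\<exists>h'. fresh_ext I (TGD b hs) h h' \<and> S = Inst (I \<union> inst h' hs))"
| "fire I (EGD b x y) h S \<longleftrightarrow> S = egd_result I (h x) (h y)"

definition hom :: "('c trm \<Rightarrow> 'c trm) \<Rightarrow> ('r,'c) atom set \<Rightarrow> ('r,'c) atom set \<Rightarrow> bool" where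
  "hom f A B \<longleftrightarrow> (\<forall>c. f (Cst c) = Cst c) \<and> (\<lambda>(r,ts). (r, map f ts)) ` A \<subseteq> B"

definition is_core_of :: "('r,'c) atom set \<Rightarrow> ('r,'c) atom set \<Rightarrow> bool" where
  "is_core_of J C \<longleftrightarrow> C \<subseteq> J \<and> (\<exists>f. hom f J C) \<and> \<not> (\<exists>C' f. C' \<subset> C \<and> hom f C C')"

definition parallel :: "('r,'c) dep set \<Rightarrow> ('r,'c) atom set \<Rightarrow> ('r,'c) atom set \<Rightarrow> bool" where
  "parallel \<Sigma> I J \<longleftrightarrow>
    (let K = {(\<xi>, restr h (bvars \<xi>)) | \<xi> h. \<xi> \<in> \<Sigma> \<and> is_tgd \<xi> \<and> is_trigger I \<xi> h \<and> active I \<xi> h}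
     in \<exists>ext. (\<forall>k\<in>K. (\<forall>v\<in>bvars (fst k). snd k v = Some (ext k v))
                      \<and> fresh_ext I (fst k) (ext k) (ext k))
           \<and> (\<forall>k\<in>K. \<forall>k'\<in>K. k \<noteq> k' \<longrightarrow> ext k ` evars (fst k) \<inter> ext k' ` evars (fst k') = {})
           \<and> J = I \<union> (\<Union>k\<in>K. inst (ext k) (heads (fst k))))"

datatype variant = Std | Obl | Sobl | CoreV

type_synonym ('r,'c) config = "('r,'c) st \<times> (('r,'c) dep \<times> (nat \<Rightarrow> 'c trm option)) set"

fun step :: "variant \<Rightarrow> ('r,'c) dep set \<Rightarrow> ('r,'c) config \<Rightarrow> ('r,'c) config \<Rightarrow> bool" where
  "step _ _ (Fail, _) _ = False"
| "step Std \<Sigma> (Inst I, H) (S', H') \<longleftrightarrow>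
     H' = H \<and> (\<exists>\<xi>\<in>\<Sigma>. \<exists>h. is_trigger I \<xi> h \<and> active I \<xi> h \<and> fire I \<xi> h S')"
| "step Obl \<Sigma> (Inst I, H) (S', H') \<longleftrightarrow>
     (\<exists>\<xi>\<in>\<Sigma>. \<exists>h. is_trigger I \<xi> h \<and> (\<xi>, restr h (bvars \<xi>)) \<notin> H \<and> fire I \<xi> h S'
        \<and> H' = insert (\<xi>, restr h (bvars \<xi>)) H)"
| "step Sobl \<Sigma> (Inst I, H) (S', H') \<longleftrightarrow>
     (\<exists>\<xi>\<in>\<Sigma>. \<exists>h. is_trigger I \<xi> h \<and> (\<xi>, restr h (key_vars \<xi>)) \<notin> H \<and> fire I \<xi> h S'
        \<and> H' = insert (\<xi>, restr h (key_vars \<xi>)) H)"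
| "step CoreV \<Sigma> (Inst I, H) (S', H') \<longleftrightarrow> H' = H \<and>
     ((\<exists>\<xi>\<in>\<Sigma>. \<exists>h. \<not> is_tgd \<xi> \<and> is_trigger I \<xi> h \<and> active I \<xi> h \<and> fire I \<xi> h S')
      \<or> (\<not> (\<exists>\<xi>\<in>\<Sigma>. \<exists>h. \<not> is_tgd \<xi> \<and> is_trigger I \<xi> h \<and> active I \<xi> h)
         \<and> (\<exists>\<xi>\<in>\<Sigma>. \<exists>h. is_tgd \<xi> \<and> is_trigger I \<xi> h \<and> active I \<xi> h)
         \<and> (\<exists>J C. parallel \<Sigma> I J \<and> is_core_of J C \<and> S' = Inst C)))"

definition terminates :: "variant \<Rightarrow> ('r,'c) dep set \<Rightarrow> ('r,'c) atom set \<Rightarrow> bool" where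
  "terminates v \<Sigma> I \<longleftrightarrow>
     \<not> (\<exists>f :: nat \<Rightarrow> ('r,'c) config. f 0 = (Inst I, {}) \<and> (\<forall>n. step v \<Sigma> (f n) (f (Suc n))))"

text \<open>Congruence rule for relation R of arity n at position i (0-based, i < n):
  variables 0..n-1 are x_1..x_n, variable n is x, variable n+1 is y.\<close>
definition repl_rule :: "'r \<Rightarrow> 'r \<Rightarrow> nat \<Rightarrow> nat \<Rightarrow> ('r,'c) dep" where
  "repl_rule E R n i =
     TGD [(E, [RVar n, RVar (Suc n)]), (R, map (\<lambda>j. if j = i then RVar n else RVar j) [0..<n])]
         [(R, map (\<lambda>j. if j = i then RVar (Suc n) else RVar j) [0..<n])]"

definition sigma_tgd :: "'r \<Rightarrow> ('r \<Rightarrow> nat) \<Rightarrow> ('r,'c) dep set \<Rightarrow> ('r,'c) dep set" where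
  "sigma_tgd E ar \<Sigma> =
      {\<xi> \<in> \<Sigma>. is_tgd \<xi>}
    \<union> {TGD b [(E, [RVar x, RVar y]), (E, [RVar y, RVar x])] | b x y. EGD b x y \<in> \<Sigma>}
    \<union> {repl_rule E R (ar R) i | R i. R \<in> rels_of \<Sigma> \<and> i < ar R}"

definition wf_dep :: "('r \<Rightarrow> nat) \<Rightarrow> ('r,'c) dep \<Rightarrow> bool" where
  "wf_dep ar \<xi> \<longleftrightarrow> (\<forall>(R,ts)\<in>set (body \<xi>) \<union> set (heads \<xi>). length ts = ar R)
     \<and> (\<forall>b x y. \<xi> = EGD b x y \<longrightarrow> x \<in> avars b \<and> y \<in> avars b)"

end

theory Submission
  imports Defs
begin

text \<open>
  A standard, oblivious or semi-oblivious chase with \<open>\<Sigma>\<close> is simulated by a chase with the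
  translated tgds: the instance \<open>I\<close> reached with \<open>\<Sigma>\<close> is the quotient modulo \<open>E\<close> of an instance
  \<open>J\<close> reached with the translated tgds. Once \<open>J\<close> is saturated under the congruence rules, triggers
  lift from \<open>I\<close> to \<open>J\<close>, so that every step of the \<open>\<Sigma>\<close>-chase is matched by a genuine step above it,
  except for egd steps between equal terms, only finitely many of which can follow one another.

  For the core chase, a terminated chase with the translated tgds yields a model \<open>J\<close>. It maps into
  some stage of any infinite core chase with \<open>\<Sigma>\<close>, with \<open>E\<close> interpreted as equality there. Hence
  \<open>J / E\<close> is a model of \<open>\<Sigma>\<close> which is homomorphically equivalent to all later stages. A core that
  is homomorphically equivalent to a model is a model, so the chase stops there.
\<close>

section \<open>Instances and homomorphisms\<close>

definition map_instance :: "('c trm \<Rightarrow> 'c trm) \<Rightarrow> ('r,'c) atom set \<Rightarrow> ('r,'c) atom set" where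
  "map_instance f I = (\<lambda>(R, ts). (R, map f ts)) ` I"

definition adom :: "('r,'c) atom set \<Rightarrow> 'c trm set" where
  "adom I = (\<Union>a\<in>I. set (snd a))"

definition terms_over :: "('r,'c) atom set \<Rightarrow> 'c trm set" where
  "terms_over I = range Cst \<union> adom I"

definition reduct :: "'r \<Rightarrow> ('r,'c) atom set \<Rightarrow> ('r,'c) atom set" where
  "reduct E I = {a \<in> I. fst a \<noteq> E}"

lemma adomI: "(R, ts) \<in> I \<Longrightarrow> t \<in> set ts \<Longrightarrow> t \<in> adom I"
  by (force simp: adom_def)

lemma adom_Un: "adom (I \<union> J) = adom I \<union> adom J"
  by (auto simp: adom_def)

lemma adom_mono: "I \<subseteq> J \<Longrightarrow> adom I \<subseteq> adom J"
  by (auto simp: adom_def)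

lemma finite_adom: "finite I \<Longrightarrow> finite (adom I)"
  by (simp add: adom_def)

lemma nulls_of_iff_adom: "n \<in> nulls_of I \<longleftrightarrow> Nul n \<in> adom I"
  by (auto simp: nulls_of_def adom_def)

lemma finite_nulls_of:
  assumes "finite I"
  shows "finite (nulls_of I)"
proof -
  have "Nul ` nulls_of I \<subseteq> adom I"
    by (auto simp: nulls_of_iff_adom)
  then have "finite (Nul ` nulls_of I :: 'b trm set)"
    using finite_adom[OF assms] by (rule finite_subset)
  then show ?thesis
    by (rule finite_imageD) (simp add: inj_on_def)
qed

lemma Cst_in_terms_over [simp]: "Cst c \<in> terms_over I"
  by (simp add: terms_over_def)

lemma Nul_in_terms_over_iff: "Nul n \<in> terms_over I \<longleftrightarrow> n \<in> nulls_of I"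
  by (auto simp: terms_over_def nulls_of_iff_adom)

lemma terms_over_Un: "terms_over (I \<union> J) = terms_over I \<union> terms_over J"
  by (auto simp: terms_over_def adom_Un)

lemma terms_over_mono: "I \<subseteq> J \<Longrightarrow> terms_over I \<subseteq> terms_over J"
  using adom_mono[of I J] by (auto simp: terms_over_def)

lemma mem_map_instance: "(R, us) \<in> map_instance f I \<longleftrightarrow> (\<exists>ts. (R, ts) \<in> I \<and> us = map f ts)"
  by (force simp: map_instance_def)

lemma map_instance_Un: "map_instance f (I \<union> J) = map_instance f I \<union> map_instance f J"
  by (simp add: map_instance_def image_Un)

lemma map_instance_UN: "map_instance f (\<Union>k\<in>K. J k) = (\<Union>k\<in>K. map_instance f (J k))"
  by (simp add: map_instance_def image_UN)

lemma map_instance_insert: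
  "map_instance f (insert (R, ts) I) = insert (R, map f ts) (map_instance f I)"
  by (simp add: map_instance_def)

lemma map_instance_mono: "I \<subseteq> J \<Longrightarrow> map_instance f I \<subseteq> map_instance f J"
  by (auto simp: map_instance_def)

lemma map_instance_comp: "map_instance g (map_instance f I) = map_instance (g \<circ> f) I"
  by (simp add: map_instance_def image_image split_beta)

lemma map_instance_cong:
  assumes "\<And>t. t \<in> adom I \<Longrightarrow> f t = g t"
  shows "map_instance f I = map_instance g I"
  unfolding map_instance_def
proof (rule image_cong[OF refl])
  fix a assume "a \<in> I"
  then show "(\<lambda>(R, ts). (R, map f ts)) a = (\<lambda>(R, ts). (R, map g ts)) a"
    using assms adomI by (cases a) fastforce
qed

lemma map_instance_ident:
  assumes "\<And>t. t \<in> adom I \<Longrightarrow> f t = t"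
  shows "map_instance f I = I"
proof -
  have "map_instance f I = map_instance id I"
    using assms by (intro map_instance_cong) simp
  then show ?thesis by (simp add: map_instance_def)
qed

lemma finite_map_instance: "finite I \<Longrightarrow> finite (map_instance f I)"
  by (simp add: map_instance_def)

lemma fst_map_instance: "fst ` map_instance f I = fst ` I"
  by (simp add: map_instance_def image_image split_beta)

lemma adom_map_instance: "adom (map_instance f I) = f ` adom I"
  by (force simp: adom_def map_instance_def)

lemma terms_over_map_instance:
  assumes "\<And>c. f (Cst c) = Cst c"
  shows "terms_over (map_instance f I) = f ` terms_over I"
  using assms by (simp add: terms_over_def adom_map_instance image_Un image_image)

lemma replace_eq_map_instance: "replace s t I = map_instance (id(s := t)) I"
proof -
  have "(\<lambda>u. if u = s then t else u) = id(s := t)"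
    by auto
  then show ?thesis
    by (simp add: replace_def map_instance_def)
qed

lemma reduct_Un: "reduct E (I \<union> J) = reduct E I \<union> reduct E J"
  by (auto simp: reduct_def)

lemma reduct_subset: "reduct E I \<subseteq> I"
  by (auto simp: reduct_def)

lemma terms_over_reduct_subset: "terms_over (reduct E I) \<subseteq> terms_over I"
  using reduct_subset by (rule terms_over_mono)

lemma reduct_ident: "E \<notin> fst ` I \<Longrightarrow> reduct E I = I"
  by (force simp: reduct_def)

lemma hom_iff_map_instance: "hom f A B \<longleftrightarrow> (\<forall>c. f (Cst c) = Cst c) \<and> map_instance f A \<subseteq> B"
  by (simp add: hom_def map_instance_def)

lemma hom_Cst: "hom f A B \<Longrightarrow> f (Cst c) = Cst c"
  by (simp add: hom_def)

lemma hom_atom: "hom f A B \<Longrightarrow> (R, ts) \<in> A \<Longrightarrow> (R, map f ts) \<in> B"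
  by (auto simp: hom_def)

lemma hom_subset: "hom f A B \<Longrightarrow> A' \<subseteq> A \<Longrightarrow> B \<subseteq> B' \<Longrightarrow> hom f A' B'"
  unfolding hom_def by blast

lemma hom_id: "A \<subseteq> B \<Longrightarrow> hom id A B"
  by (auto simp: hom_def)

lemma hom_comp: "hom f A B \<Longrightarrow> hom g B C \<Longrightarrow> hom (g \<circ> f) A C"
  unfolding hom_iff_map_instance map_instance_comp[symmetric]
  using map_instance_mono[of "map_instance f A" B g] by auto

lemma hom_reduct: "hom f A B \<Longrightarrow> hom f (reduct E A) (reduct E B)"
  by (auto simp: hom_def reduct_def)

section \<open>Instantiated conjunctions and triggers\<close>

lemma inst_subset_iff: "inst h as \<subseteq> I \<longleftrightarrow> (\<forall>R ts. (R, ts) \<in> set as \<longrightarrow> (R, map (inst_t h) ts) \<in> I)"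
  by (auto simp: inst_def)

lemma finite_inst: "finite (inst h as)"
  by (simp add: inst_def)

lemma fst_inst: "fst ` inst h as = fst ` set as"
  by (simp add: inst_def image_image split_beta)

lemma finite_avars: "finite (avars (as :: ('r,'c) ratom list))"
proof -
  have "finite (rvars t)" for t :: "'c rtrm"
    by (cases t) auto
  then show ?thesis
    by (simp add: avars_def)
qed

lemma finite_bvars: "finite (bvars \<xi>)" and finite_evars: "finite (evars \<xi>)"
  by (simp_all add: bvars_def evars_def finite_avars)

lemma avars_heads_subset: "avars (heads \<xi>) \<subseteq> bvars \<xi> \<union> evars \<xi>"
  by (auto simp: bvars_def evars_def)

lemma inst_cong:
  assumes "\<And>v. v \<in> avars as \<Longrightarrow> h v = h' v"
  shows "inst h as = inst h' as"
proof -
  have "inst_t h t = inst_t h' t" if "(R, ts) \<in> set as" "t \<in> set ts" for R ts t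
    using that assms by (cases t) (force simp: avars_def)+
  then show ?thesis
    unfolding inst_def by (intro image_cong refl) auto
qed

lemma inst_comp:
  assumes "\<And>c. f (Cst c) = Cst c"
  shows "inst (f \<circ> h) as = map_instance f (inst h as)"
proof -
  have "inst_t (f \<circ> h) = f \<circ> inst_t h"
  proof
    fix t show "inst_t (f \<circ> h) t = (f \<circ> inst_t h) t"
      using assms by (cases t) auto
  qed
  then show ?thesis
    by (simp add: inst_def map_instance_def image_image split_beta)
qed

lemma inst_hom:
  assumes "hom f A B" "inst h as \<subseteq> A"
  shows "inst (f \<circ> h) as \<subseteq> B"
proof -
  have "inst (f \<circ> h) as = map_instance f (inst h as)"
    using hom_Cst[OF assms(1)] by (rule inst_comp)
  also have "\<dots> \<subseteq> map_instance f A"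
    using assms(2) by (rule map_instance_mono)
  also have "\<dots> \<subseteq> B"
    using assms(1) by (simp add: hom_iff_map_instance)
  finally show ?thesis .
qed

lemma terms_over_inst: "terms_over (inst h as) = range Cst \<union> h ` avars as"
proof (intro equalityI subsetI)
  fix t assume "t \<in> terms_over (inst h as)"
  then consider (const) "t \<in> range Cst"
    | (atom) R ts u where "(R, ts) \<in> set as" "u \<in> set ts" "t = inst_t h u"
    by (auto simp: terms_over_def adom_def inst_def)
  then show "t \<in> range Cst \<union> h ` avars as"
  proof cases
    case (atom R ts u)
    then show ?thesis
      by (cases u) (force simp: avars_def)+
  qed simp
next
  fix t assume "t \<in> range Cst \<union> h ` avars as"
  then consider (const) "t \<in> range Cst"
    | (variable) R ts u v where "(R, ts) \<in> set as" "u \<in> set ts" "v \<in> rvars u" "t = h v"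
    by (auto simp: avars_def)
  then show "t \<in> terms_over (inst h as)"
  proof cases
    case (variable R ts u v)
    then have "t = inst_t h u"
      by (cases u) auto
    then show ?thesis
      using variable(1,2) by (force simp: terms_over_def adom_def inst_def)
  qed (auto simp: terms_over_def)
qed

lemma avars_in_adom:
  assumes "v \<in> avars as" "inst h as \<subseteq> I"
  shows "h v \<in> adom I"
proof -
  obtain R ts u where occurrence: "(R, ts) \<in> set as" "u \<in> set ts" "v \<in> rvars u"
    using assms(1) by (auto simp: avars_def)
  then have "h v = inst_t h u"
    by (cases u) auto
  then show ?thesis
    using occurrence assms(2) by (force simp: inst_subset_iff intro!: adomI)
qed

lemma trigger_in_adom: "is_trigger I \<xi> h \<Longrightarrow> v \<in> bvars \<xi> \<Longrightarrow> h v \<in> adom I"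
  unfolding is_trigger_def bvars_def by (rule avars_in_adom)

lemma trigger_in_terms_over: "is_trigger I \<xi> h \<Longrightarrow> h ` bvars \<xi> \<subseteq> terms_over I"
  using trigger_in_adom by (force simp: terms_over_def)

lemma is_trigger_hom: "hom f A B \<Longrightarrow> is_trigger A \<xi> h \<Longrightarrow> is_trigger B \<xi> (f \<circ> h)"
  unfolding is_trigger_def by (rule inst_hom)

lemma inst_subset_reduct_iff:
  assumes "E \<notin> fst ` set as"
  shows "inst h as \<subseteq> reduct E I \<longleftrightarrow> inst h as \<subseteq> I"
  using assms unfolding fst_inst[of h as, symmetric] by (auto simp: reduct_def)

definition head_satisfied :: "('r,'c) atom set \<Rightarrow> ('r,'c) dep \<Rightarrow> (nat \<Rightarrow> 'c trm) \<Rightarrow> bool" where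
  "head_satisfied I \<xi> h \<longleftrightarrow> (\<exists>h'. (\<forall>v\<in>bvars \<xi>. h' v = h v) \<and> inst h' (heads \<xi>) \<subseteq> I)"

lemma active_iff_not_head_satisfied: "is_tgd \<xi> \<Longrightarrow> active I \<xi> h \<longleftrightarrow> \<not> head_satisfied I \<xi> h"
  by (cases \<xi>) (auto simp: head_satisfied_def bvars_def)

lemma head_satisfied_mono: "head_satisfied I \<xi> h \<Longrightarrow> I \<subseteq> J \<Longrightarrow> head_satisfied J \<xi> h"
  unfolding head_satisfied_def by blast

lemma head_satisfied_cong:
  assumes "\<And>v. v \<in> bvars \<xi> \<Longrightarrow> h v = h' v"
  shows "head_satisfied I \<xi> h \<longleftrightarrow> head_satisfied I \<xi> h'"
  using assms by (simp add: head_satisfied_def)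

lemma head_satisfied_hom:
  assumes "hom f A B" "head_satisfied A \<xi> h"
  shows "head_satisfied B \<xi> (f \<circ> h)"
proof -
  obtain h' where "\<forall>v\<in>bvars \<xi>. h' v = h v" "inst h' (heads \<xi>) \<subseteq> A"
    using assms(2) by (auto simp: head_satisfied_def)
  then show ?thesis
    unfolding head_satisfied_def using inst_hom[OF assms(1)]
    by (intro exI[of _ "f \<circ> h'"]) simp
qed

lemma head_satisfied_reduct_iff:
  "E \<notin> fst ` set (heads \<xi>) \<Longrightarrow> head_satisfied (reduct E I) \<xi> h \<longleftrightarrow> head_satisfied I \<xi> h"
  by (simp add: head_satisfied_def inst_subset_reduct_iff)

lemma head_satisfied_full_iff:
  assumes "evars \<xi> = {}"
  shows "head_satisfied I \<xi> h \<longleftrightarrow> inst h (heads \<xi>) \<subseteq> I"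
proof -
  have "inst h' (heads \<xi>) = inst h (heads \<xi>)" if "\<forall>v\<in>bvars \<xi>. h' v = h v" for h'
    using that assms avars_heads_subset by (intro inst_cong) blast
  then show ?thesis
    unfolding head_satisfied_def by blast
qed

lemma restr_eq_iff: "restr h V = restr h' V \<longleftrightarrow> (\<forall>v\<in>V. h v = h' v)"
  by (force simp: restr_def fun_eq_iff)

lemma ran_restr: "ran (restr h V) = h ` V"
  by (auto simp: ran_def restr_def)

lemma finite_trigger_keys:
  assumes "finite \<Sigma>" "finite I" "\<And>\<xi>. V \<xi> \<subseteq> bvars \<xi>"
  shows "finite {(\<xi>, restr h (V \<xi>)) | \<xi> h. \<xi> \<in> \<Sigma> \<and> is_trigger I \<xi> h}" (is "finite ?K")
proof (rule finite_subset)
  let ?M = "\<lambda>\<xi>. {m. dom m = V \<xi> \<and> ran m \<subseteq> adom I}"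
  show "?K \<subseteq> (\<Union>\<xi>\<in>\<Sigma>. Pair \<xi> ` ?M \<xi>)"
  proof
    fix k assume "k \<in> ?K"
    then obtain \<xi> h where key: "k = (\<xi>, restr h (V \<xi>))" "\<xi> \<in> \<Sigma>" and trigger: "is_trigger I \<xi> h"
      by auto
    have "ran (restr h (V \<xi>)) \<subseteq> adom I"
      using trigger_in_adom[OF trigger] assms(3) by (force simp: ran_restr)
    moreover have "dom (restr h (V \<xi>)) = V \<xi>"
      by (auto simp: dom_def restr_def)
    ultimately show "k \<in> (\<Union>\<xi>\<in>\<Sigma>. Pair \<xi> ` ?M \<xi>)"
      using key by auto
  qed
  have "finite (V \<xi>)" for \<xi>
    using assms(3) finite_bvars by (rule finite_subset)
  then show "finite (\<Union>\<xi>\<in>\<Sigma>. Pair \<xi> ` ?M \<xi>)"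
    using assms(1,2) by (auto intro!: finite_set_of_finite_maps finite_adom)
qed

section \<open>Fresh nulls\<close>

lemma fresh_nulls_exist:
  assumes "finite A" "finite I"
  shows "\<exists>u :: 'a \<Rightarrow> 'c trm. inj_on u A \<and> (\<forall>x\<in>A. \<exists>n. u x = Nul n \<and> n \<notin> nulls_of I)"
proof -
  obtain idx :: "'a \<Rightarrow> nat" where inj: "inj_on idx A"
    using finite_imp_inj_to_nat_seg[OF assms(1)] by metis
  obtain B where bound: "\<And>n. n \<in> nulls_of I \<Longrightarrow> n < B"
    using finite_nulls_of[OF assms(2)] finite_nat_set_iff_bounded by auto
  have "inj_on (\<lambda>x. Nul (B + idx x)) A"
    using inj by (simp add: inj_on_def)
  moreover have "B + n \<notin> nulls_of I" for n
    using bound[of "B + n"] by auto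
  ultimately show ?thesis by blast
qed

lemma fresh_ext_exists:
  fixes I :: "('r,'c) atom set"
  assumes "finite I"
  shows "\<exists>h'. fresh_ext I \<xi> h h'"
proof -
  obtain u :: "nat \<Rightarrow> 'c trm" where fresh: "inj_on u (evars \<xi>)"
      "\<forall>v\<in>evars \<xi>. \<exists>n. u v = Nul n \<and> n \<notin> nulls_of I"
    using fresh_nulls_exist[OF finite_evars assms] by blast
  have "fresh_ext I \<xi> h (\<lambda>v. if v \<in> evars \<xi> then u v else h v)"
    using fresh by (auto simp: fresh_ext_def evars_def bvars_def inj_on_def)
  then show ?thesis by blast
qed

lemma fresh_ext_refl: "evars \<xi> = {} \<Longrightarrow> fresh_ext I \<xi> h h"
  by (simp add: fresh_ext_def)

lemma fresh_ext_not_in_terms_over: "fresh_ext I \<xi> h h' \<Longrightarrow> v \<in> evars \<xi> \<Longrightarrow> h' v \<notin> terms_over I"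
  by (auto simp: fresh_ext_def Nul_in_terms_over_iff)

lemma terms_over_extended:
  assumes "\<And>v. v \<in> bvars \<xi> \<Longrightarrow> h' v = h v" "h ` bvars \<xi> \<subseteq> terms_over I"
  shows "terms_over (I \<union> inst h' (heads \<xi>)) = terms_over I \<union> h' ` evars \<xi>"
proof -
  have "h' ` avars (heads \<xi>) \<subseteq> terms_over I \<union> h' ` evars \<xi>"
    using assms avars_heads_subset[of \<xi>] by fastforce
  moreover have "evars \<xi> \<subseteq> avars (heads \<xi>)"
    by (auto simp: evars_def)
  ultimately show ?thesis
    by (auto simp: terms_over_Un terms_over_inst)
qed

definition redirect :: "'a set \<Rightarrow> ('a \<Rightarrow> 'b) \<Rightarrow> ('a \<Rightarrow> 'd) \<Rightarrow> ('b \<Rightarrow> 'd) \<Rightarrow> 'b \<Rightarrow> 'd" where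
  "redirect A u u' f t = (if t \<in> u ` A then u' (inv_into A u t) else f t)"

lemma redirect_image: "inj_on u A \<Longrightarrow> x \<in> A \<Longrightarrow> redirect A u u' f (u x) = u' x"
  by (simp add: redirect_def)

lemma redirect_other: "t \<notin> u ` A \<Longrightarrow> redirect A u u' f t = f t"
  by (simp add: redirect_def)

section \<open>Quotients modulo \<open>E\<close>\<close>

text \<open>No congruence rule forces \<open>E\<close> to be symmetric, but the translated egds add both
  orientations at once, so the symmetric part of \<open>E\<close> suffices.\<close>
definition Erel :: "'r \<Rightarrow> ('r,'c) atom set \<Rightarrow> ('c trm \<times> 'c trm) set" where
  "Erel E J = {(s, t). (E, [s, t]) \<in> J \<and> (E, [t, s]) \<in> J}"

definition saturated :: "'r \<Rightarrow> ('r \<Rightarrow> nat) \<Rightarrow> 'r set \<Rightarrow> ('r,'c) atom set \<Rightarrow> bool" where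
  "saturated E ar \<R> J \<longleftrightarrow> (\<forall>R\<in>\<R>. \<forall>us i t. (R, us) \<in> J \<longrightarrow> length us = ar R \<longrightarrow> i < ar R \<longrightarrow>
     (us ! i, t) \<in> Erel E J \<longrightarrow> (R, us[i := t]) \<in> J)"

lemma Erel_rtrancl_sym: "(s, t) \<in> (Erel E J)\<^sup>* \<Longrightarrow> (t, s) \<in> (Erel E J)\<^sup>*"
proof -
  have "sym (Erel E J)"
    by (auto simp: sym_def Erel_def)
  then show "(s, t) \<in> (Erel E J)\<^sup>* \<Longrightarrow> (t, s) \<in> (Erel E J)\<^sup>*"
    by (metis sym_rtrancl symD)
qed

lemma Erel_rtrancl_mono: "I \<subseteq> J \<Longrightarrow> (Erel E I)\<^sup>* \<subseteq> (Erel E J)\<^sup>*"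
  by (intro rtrancl_mono) (auto simp: Erel_def)

lemma Erel_Un_not_E: "E \<notin> fst ` K \<Longrightarrow> Erel E (J \<union> K) = Erel E J"
  by (force simp: Erel_def)

lemma Erel_in_adom: "(s, t) \<in> Erel E J \<Longrightarrow> s \<in> adom J \<and> t \<in> adom J"
  by (auto simp: Erel_def intro: adomI)

lemma equiv_representatives:
  assumes equiv: "equiv UNIV r" and separated: "\<And>a b. a \<in> A \<Longrightarrow> b \<in> A \<Longrightarrow> (a, b) \<in> r \<Longrightarrow> a = b"
  obtains q where "\<And>a. a \<in> A \<Longrightarrow> q a = a" "\<And>s t. q s = q t \<longleftrightarrow> (s, t) \<in> r"
proof -
  define q where
    "q s = (if r `` {s} \<inter> A = {} then SOME t. t \<in> r `` {s} else SOME t. t \<in> r `` {s} \<inter> A)" for s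
  have self: "s \<in> r `` {s}" for s
    using equiv UNIV_I by (rule equiv_class_self)
  have q_rel: "(s, q s) \<in> r" for s
  proof (cases "r `` {s} \<inter> A = {}")
    case True
    then show ?thesis
      using someI[of "\<lambda>t. t \<in> r `` {s}", OF self] by (simp add: q_def)
  next
    case False
    then show ?thesis
      using some_in_eq[of "r `` {s} \<inter> A"] by (simp add: q_def)
  qed
  have "q a = a" if "a \<in> A" for a
  proof -
    have "r `` {a} \<inter> A = {a}"
      using that self separated by blast
    then show ?thesis by (simp add: q_def)
  qed
  moreover have "q s = q t \<longleftrightarrow> (s, t) \<in> r" for s t
  proof
    assume "q s = q t"
    then show "(s, t) \<in> r"
      using q_rel[of s] q_rel[of t] equiv by (metis equivE symE transE)
  next
    assume "(s, t) \<in> r"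
    then have "r `` {s} = r `` {t}"
      using equiv by (rule equiv_class_eq[rotated])
    then show "q s = q t" by (simp add: q_def)
  qed
  ultimately show thesis using that by blast
qed

lemma closed_under_update_rtrancl:
  assumes upd: "\<And>us i t. P us \<Longrightarrow> i < length us \<Longrightarrow> (us ! i, t) \<in> r \<Longrightarrow> P (us[i := t])"
    and "P us" "i < length us" and "(us ! i, t) \<in> r\<^sup>*"
  shows "P (us[i := t])"
  using assms(4)
proof (induction rule: rtrancl_induct)
  case base
  then show ?case using assms(2) by simp
next
  case (step s t)
  then show ?case
    using upd[of "us[i := s]" i t] assms(3) by simp
qed

lemma closed_under_list_all2_rtrancl:
  assumes upd: "\<And>us i t. P us \<Longrightarrow> i < length us \<Longrightarrow> (us ! i, t) \<in> r \<Longrightarrow> P (us[i := t])"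
    and "list_all2 (\<lambda>s t. (s, t) \<in> r\<^sup>*) us ts" "P us"
  shows "P ts"
proof -
  have "P (ps @ us) \<Longrightarrow> P (ps @ ts)" for ps
    using assms(2)
  proof (induction us ts arbitrary: ps rule: list_all2_induct)
    case (Cons s us t ts)
    have "P ((ps @ s # us)[length ps := t])"
      using Cons by (intro closed_under_update_rtrancl[of P r, OF upd]) auto
    then show ?case
      using Cons.IH[of "ps @ [t]"] by simp
  qed simp
  from this[of "[]"] show ?thesis
    using assms(3) by simp
qed

lemma saturated_list_all2:
  assumes sat: "saturated E ar \<R> J" and "R \<in> \<R>" and atom: "(R, us) \<in> J" "length us = ar R"
    and "list_all2 (\<lambda>s t. (s, t) \<in> (Erel E J)\<^sup>*) us ts"
  shows "(R, ts) \<in> J"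
proof -
  let ?P = "\<lambda>us. (R, us) \<in> J \<and> length us = ar R"
  have "?P (us[i := t])" if "?P us" "i < length us" "(us ! i, t) \<in> Erel E J" for us i t
    using that sat \<open>R \<in> \<R>\<close> unfolding saturated_def by simp
  from closed_under_list_all2_rtrancl[of ?P, OF this assms(5)] show ?thesis
    using atom by blast
qed

text \<open>\<open>q\<close> is the projection of \<open>J\<close> onto its quotient \<open>I\<close>, and \<open>e\<close> is a section of \<open>q\<close>.\<close>
locale E_quotient =
  fixes E :: 'r and J I :: "('r,'c) atom set" and q e :: "'c trm \<Rightarrow> 'c trm"
  assumes q_Cst: "q (Cst c) = Cst c"
    and quotient_eq: "I = map_instance q (reduct E J)"
    and q_Erel: "(s, t) \<in> Erel E J \<Longrightarrow> q s = q t"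
    and connected: "s \<in> terms_over (reduct E J) \<Longrightarrow> t \<in> terms_over (reduct E J) \<Longrightarrow> q s = q t \<Longrightarrow>
      (s, t) \<in> (Erel E J)\<^sup>*"
    and e_in: "a \<in> terms_over I \<Longrightarrow> e a \<in> terms_over (reduct E J)"
    and q_e: "a \<in> terms_over I \<Longrightarrow> q (e a) = a"
begin

lemma terms_over_quotient: "terms_over I = q ` terms_over (reduct E J)"
  using quotient_eq q_Cst by (simp add: terms_over_map_instance)

lemma q_in: "s \<in> terms_over (reduct E J) \<Longrightarrow> q s \<in> terms_over I"
  by (simp add: terms_over_quotient)

lemma e_in_J: "a \<in> terms_over I \<Longrightarrow> e a \<in> terms_over J"
  by (rule subsetD[OF terms_over_reduct_subset e_in])

lemma e_q_connected: "s \<in> terms_over (reduct E J) \<Longrightarrow> (s, e (q s)) \<in> (Erel E J)\<^sup>*"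
  using connected e_in q_e q_in by simp

lemma q_connected: "(s, t) \<in> (Erel E J)\<^sup>* \<Longrightarrow> q s = q t"
  by (induction rule: rtrancl_induct) (simp_all add: q_Erel)

lemma inj_on_e: "inj_on e (terms_over I)"
  using q_e by (metis inj_onI)

lemma hom_q: "hom q (reduct E J) I"
  using q_Cst quotient_eq by (simp add: hom_iff_map_instance)

lemma hom_factor:
  assumes hom: "hom g (reduct E J) X" and respects: "\<And>s t. (s, t) \<in> Erel E J \<Longrightarrow> g s = g t"
  shows "hom (g \<circ> e) I X"
proof -
  have "g s = g t" if "(s, t) \<in> (Erel E J)\<^sup>*" for s t
    using that by (induction rule: rtrancl_induct) (simp_all add: respects)
  then have g_e_q: "g (e (q s)) = g s" if "s \<in> terms_over (reduct E J)" for s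
    using e_q_connected[OF that] by metis
  have "map_instance (g \<circ> e) I = map_instance (g \<circ> e \<circ> q) (reduct E J)"
    unfolding quotient_eq by (rule map_instance_comp)
  also have "\<dots> = map_instance g (reduct E J)"
    using g_e_q by (intro map_instance_cong) (simp add: terms_over_def)
  finally show ?thesis
    using hom g_e_q[of "Cst _"] q_Cst by (simp add: hom_iff_map_instance)
qed

lemma lift_conjunction:
  assumes sat: "saturated E ar \<R> J"
    and wf: "\<And>R ts. (R, ts) \<in> set as \<Longrightarrow> R \<in> \<R> \<and> length ts = ar R"
    and holds: "inst h as \<subseteq> I"
  shows "inst (e \<circ> h) as \<subseteq> J"
  unfolding inst_subset_iff
proof (intro allI impI)
  fix R ts assume atom: "(R, ts) \<in> set as"
  have "(R, map (inst_t h) ts) \<in> I"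
    using holds atom by (simp add: inst_subset_iff)
  then obtain ws where preimage: "(R, ws) \<in> reduct E J" "map (inst_t h) ts = map q ws"
    unfolding quotient_eq mem_map_instance by blast
  have len: "length ws = length ts"
    using preimage(2) by (metis length_map)
  have "(ws ! i, inst_t (e \<circ> h) (ts ! i)) \<in> (Erel E J)\<^sup>*" if i: "i < length ts" for i
  proof -
    have ws_i: "ws ! i \<in> terms_over (reduct E J)"
      using preimage(1) i len by (auto simp: terms_over_def intro: adomI)
    have q_ws: "q (ws ! i) = inst_t h (ts ! i)"
      using preimage(2) i len by (metis nth_map)
    show ?thesis
    proof (cases "ts ! i")
      case (RVar v)
      then show ?thesis using e_q_connected[OF ws_i] q_ws by simp
    next
      case (RCst c)
      then show ?thesis using connected[OF ws_i, of "Cst c"] q_ws q_Cst by simp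
    qed
  qed
  then have connected_ts: "list_all2 (\<lambda>s t. (s, t) \<in> (Erel E J)\<^sup>*) ws (map (inst_t (e \<circ> h)) ts)"
    using len by (simp add: list_all2_conv_all_nth)
  have "R \<in> \<R>" "(R, ws) \<in> J" "length ws = ar R"
    using wf[OF atom] preimage(1) len by (auto simp: reduct_def)
  then show "(R, map (inst_t (e \<circ> h)) ts) \<in> J"
    by (rule saturated_list_all2[OF sat _ _ _ connected_ts])
qed

lemma connected_via:
  assumes "s0 \<in> terms_over (reduct E J)" "t0 \<in> terms_over (reduct E J)"
    and to_s: "(s0, s) \<in> (Erel E J)\<^sup>*" and to_t: "(t0, t) \<in> (Erel E J)\<^sup>*" and "q s = q t"
  shows "(s, t) \<in> (Erel E J)\<^sup>*"
proof -
  have "q s0 = q t0"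
    using q_connected[OF to_s] q_connected[OF to_t] \<open>q s = q t\<close> by simp
  then have "(s0, t0) \<in> (Erel E J)\<^sup>*"
    using assms(1,2) by (intro connected)
  then have "(s, t0) \<in> (Erel E J)\<^sup>*"
    by (rule rtrancl_trans[OF Erel_rtrancl_sym[OF to_s]])
  then show ?thesis
    using to_t by (rule rtrancl_trans)
qed

lemma terms_over_congruent_atom:
  assumes atom: "(R, us) \<in> reduct E J" "i < length us" and edge: "(us ! i, t) \<in> Erel E J"
    and member: "s \<in> terms_over (insert (R, us[i := t]) (reduct E J))"
  shows "\<exists>s0\<in>terms_over (reduct E J). (s0, s) \<in> (Erel E J)\<^sup>*"
proof -
  have "s \<in> terms_over (reduct E J) \<or> s = t"
    using member atom(1) set_update_subset_insert[of us i t]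
    by (force simp: terms_over_def adom_def)
  moreover have "us ! i \<in> terms_over (reduct E J)"
    using atom by (auto simp: terms_over_def intro: adomI)
  ultimately show ?thesis
    using edge by blast
qed

lemma E_quotient_congruent_atom:
  assumes "(R, us) \<in> J" "i < length us" "R \<noteq> E" and edge: "(us ! i, t) \<in> Erel E J"
  shows "E_quotient E (J \<union> {(R, us[i := t])}) I q e"
proof
  let ?J = "J \<union> {(R, us[i := t])}"
  have reduct_J: "reduct E ?J = insert (R, us[i := t]) (reduct E J)"
    using assms(3) by (auto simp: reduct_def)
  have atom: "(R, us) \<in> reduct E J"
    using assms(1,3) by (simp add: reduct_def)
  have Erel_J: "Erel E ?J = Erel E J"
    using assms(3) by (intro Erel_Un_not_E) auto
  show "q (Cst c) = Cst c" for c by (rule q_Cst)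
  show "I = map_instance q (reduct E ?J)"
  proof -
    have "map q (us[i := t]) = map q us"
      using assms(2) q_Erel[OF edge] by (simp add: map_update list_update_same_conv)
    then show ?thesis
      using atom unfolding reduct_J map_instance_insert quotient_eq by (auto simp: mem_map_instance)
  qed
  show "q s = q t" if "(s, t) \<in> Erel E ?J" for s t
    using q_Erel that Erel_J by simp
  show "(s, t) \<in> (Erel E ?J)\<^sup>*"
    if "s \<in> terms_over (reduct E ?J)" "t \<in> terms_over (reduct E ?J)" "q s = q t" for s t
    using terms_over_congruent_atom[OF atom assms(2) edge] connected_via that
    unfolding reduct_J Erel_J by meson
  show "e a \<in> terms_over (reduct E ?J)" if "a \<in> terms_over I" for a
    using e_in[OF that] terms_over_mono[of "reduct E J" "reduct E ?J"] reduct_J by blast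
  show "q (e a) = a" if "a \<in> terms_over I" for a
    using that by (rule q_e)
qed

lemma connected_merged:
  assumes "s \<in> terms_over (reduct E J)" "t \<in> terms_over (reduct E J)"
    and "u \<in> terms_over (reduct E J)" "q u \<in> {q s, q t}"
  shows "(u, s) \<in> (Erel E (J \<union> {(E, [s, t]), (E, [t, s])}))\<^sup>*" (is "_ \<in> (Erel E ?J)\<^sup>*")
proof -
  have "(u, s) \<in> (Erel E J)\<^sup>* \<or> (u, t) \<in> (Erel E J)\<^sup>*"
    using connected assms by auto
  moreover have "(Erel E J)\<^sup>* \<subseteq> (Erel E ?J)\<^sup>*"
    by (intro Erel_rtrancl_mono) blast
  moreover have "(t, s) \<in> Erel E ?J"
    by (simp add: Erel_def)
  ultimately show ?thesis
    by (auto intro: rtrancl.rtrancl_into_rtrancl)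
qed

lemma terms_over_merged:
  assumes "{Nul n, w} \<subseteq> terms_over I" "w \<noteq> Nul n"
  shows "terms_over (replace (Nul n) w I) \<subseteq> terms_over I - {Nul n}"
proof -
  have "terms_over (replace (Nul n) w I) = id(Nul n := w) ` terms_over I"
    unfolding replace_eq_map_instance by (intro terms_over_map_instance) simp
  then show ?thesis
    using assms by auto
qed

lemma E_quotient_merged:
  assumes members: "s \<in> terms_over (reduct E J)" "t \<in> terms_over (reduct E J)"
    and merge: "{Nul n, w} = {q s, q t}" "w \<noteq> Nul n"
  shows "E_quotient E (J \<union> {(E, [s, t]), (E, [t, s])}) (replace (Nul n) w I) (id(Nul n := w) \<circ> q) e"
proof
  let ?J = "J \<union> {(E, [s, t]), (E, [t, s])}" and ?m = "id(Nul n := w)"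
  have reduct_J: "reduct E ?J = reduct E J"
    by (auto simp: reduct_def)
  have terms_I: "terms_over (replace (Nul n) w I) \<subseteq> terms_over I - {Nul n}"
    using merge q_in members by (intro terms_over_merged) auto
  show "(?m \<circ> q) (Cst c) = Cst c" for c
    by (simp add: q_Cst)
  show "replace (Nul n) w I = map_instance (?m \<circ> q) (reduct E ?J)"
    unfolding reduct_J quotient_eq replace_eq_map_instance by (rule map_instance_comp)
  have "Erel E ?J = Erel E J \<union> {(s, t), (t, s)}"
    by (auto simp: Erel_def)
  moreover have "?m (q s) = ?m (q t)"
    using merge by (auto simp: doubleton_eq_iff)
  ultimately show "(?m \<circ> q) u = (?m \<circ> q) u'" if "(u, u') \<in> Erel E ?J" for u u'
    using that q_Erel by auto
  show "(u, u') \<in> (Erel E ?J)\<^sup>*"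
    if in_terms: "u \<in> terms_over (reduct E ?J)" "u' \<in> terms_over (reduct E ?J)"
      and eq: "(?m \<circ> q) u = (?m \<circ> q) u'" for u u'
  proof (cases "q u = q u'")
    case True
    then show ?thesis
      using connected in_terms Erel_rtrancl_mono[of J ?J E] unfolding reduct_J by blast
  next
    case False
    then have "q u \<in> {q s, q t}" "q u' \<in> {q s, q t}"
      using eq merge(1)[symmetric] by (auto split: if_splits)
    then show ?thesis
      using connected_merged[OF members] in_terms Erel_rtrancl_sym rtrancl_trans
      unfolding reduct_J by metis
  qed
  show "e a \<in> terms_over (reduct E ?J)" if "a \<in> terms_over (replace (Nul n) w I)" for a
    using that terms_I e_in unfolding reduct_J by blast
  show "(?m \<circ> q) (e a) = a" if "a \<in> terms_over (replace (Nul n) w I)" for a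
    using that terms_I q_e by auto
qed

end

lemma E_quotient_exists:
  assumes "\<And>c d. (Cst c, Cst d) \<in> (Erel E J)\<^sup>* \<Longrightarrow> c = d"
  shows "\<exists>I q e. E_quotient E J I q e"
proof -
  have "equiv UNIV ((Erel E J)\<^sup>*)"
    using Erel_rtrancl_sym[of _ _ E J] by (simp add: equiv_def sym_def refl_rtrancl trans_rtrancl)
  then obtain q where "\<And>a. a \<in> range Cst \<Longrightarrow> q a = a"
    and q_iff: "\<And>s t. q s = q t \<longleftrightarrow> (s, t) \<in> (Erel E J)\<^sup>*"
    using equiv_representatives[of "(Erel E J)\<^sup>*" "range Cst"] assms by blast
  then have q_Cst: "q (Cst c) = Cst c" for c
    by blast
  let ?D = "terms_over (reduct E J)" and ?I = "map_instance q (reduct E J)"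
  have terms_I: "terms_over ?I = q ` ?D"
    using q_Cst by (rule terms_over_map_instance)
  have "E_quotient E J ?I q (inv_into ?D q)"
    by unfold_locales (use q_Cst q_iff terms_I in \<open>auto simp: inv_into_into f_inv_into_f\<close>)
  then show ?thesis by blast
qed

text \<open>When a tgd is fired on both sides, projection and section exchange the two families of
  fresh nulls.\<close>
locale E_quotient_tgd = E_quotient E J I q e
  for E :: 'r and J I :: "('r,'c) atom set" and q e :: "'c trm \<Rightarrow> 'c trm" +
  fixes \<xi> :: "('r,'c) dep" and h h' g' :: "nat \<Rightarrow> 'c trm"
  assumes heads_not_E: "E \<notin> fst ` set (heads \<xi>)"
    and trigger: "is_trigger I \<xi> h"
    and fresh_I: "fresh_ext I \<xi> h h'"
    and fresh_J: "fresh_ext J \<xi> (e \<circ> h) g'"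
begin

definition q_ext :: "'c trm \<Rightarrow> 'c trm" where "q_ext = redirect (evars \<xi>) g' h' q"
definition e_ext :: "'c trm \<Rightarrow> 'c trm" where "e_ext = redirect (evars \<xi>) h' g' e"

lemma h_in: "h ` bvars \<xi> \<subseteq> terms_over I"
  using trigger by (rule trigger_in_terms_over)

lemma fresh_nulls_disjoint: "terms_over I \<inter> h' ` evars \<xi> = {}" "terms_over J \<inter> g' ` evars \<xi> = {}"
  using fresh_ext_not_in_terms_over[OF fresh_I] fresh_ext_not_in_terms_over[OF fresh_J] by blast+

lemma q_ext_old: "t \<in> terms_over J \<Longrightarrow> q_ext t = q t"
  and e_ext_old: "a \<in> terms_over I \<Longrightarrow> e_ext a = e a"
  using fresh_nulls_disjoint unfolding q_ext_def e_ext_def by (blast intro: redirect_other)+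

lemma q_ext_old_reduct: "t \<in> terms_over (reduct E J) \<Longrightarrow> q_ext t = q t"
  by (rule q_ext_old[OF subsetD[OF terms_over_reduct_subset]])

lemma q_ext_fresh: "v \<in> evars \<xi> \<Longrightarrow> q_ext (g' v) = h' v"
  and e_ext_fresh: "v \<in> evars \<xi> \<Longrightarrow> e_ext (h' v) = g' v"
  using fresh_I fresh_J
  unfolding q_ext_def e_ext_def fresh_ext_def by (simp_all add: redirect_image)

lemma q_ext_head: "v \<in> avars (heads \<xi>) \<Longrightarrow> q_ext (g' v) = h' v"
proof (cases "v \<in> bvars \<xi>")
  case True
  then have "g' v = e (h v)" "h' v = h v" "h v \<in> terms_over I"
    using fresh_I fresh_J h_in by (auto simp: fresh_ext_def)
  then show ?thesis
    using q_ext_old e_in_J q_e by simp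
next
  case False
  assume "v \<in> avars (heads \<xi>)"
  with False show ?thesis
    using avars_heads_subset[of \<xi>] q_ext_fresh by blast
qed

lemma q_ext_Cst: "q_ext (Cst c) = Cst c"
  using q_ext_old[of "Cst c"] q_Cst by simp

lemma reduct_fired: "reduct E (J \<union> inst g' (heads \<xi>)) = reduct E J \<union> inst g' (heads \<xi>)"
  using heads_not_E by (simp add: reduct_Un reduct_ident fst_inst)

lemma Erel_fired: "Erel E (J \<union> inst g' (heads \<xi>)) = Erel E J"
  using heads_not_E by (simp add: Erel_Un_not_E fst_inst)

lemma terms_over_fired:
  "terms_over (I \<union> inst h' (heads \<xi>)) = terms_over I \<union> h' ` evars \<xi>"
  "terms_over (reduct E (J \<union> inst g' (heads \<xi>))) = terms_over (reduct E J) \<union> g' ` evars \<xi>"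
proof -
  show "terms_over (I \<union> inst h' (heads \<xi>)) = terms_over I \<union> h' ` evars \<xi>"
    using fresh_I h_in by (intro terms_over_extended) (auto simp: fresh_ext_def)
  show "terms_over (reduct E (J \<union> inst g' (heads \<xi>))) = terms_over (reduct E J) \<union> g' ` evars \<xi>"
    unfolding reduct_fired using fresh_J h_in e_in
    by (intro terms_over_extended[of _ _ "e \<circ> h"]) (auto simp: fresh_ext_def)
qed

lemma quotient_fired:
  "I \<union> inst h' (heads \<xi>) = map_instance q_ext (reduct E (J \<union> inst g' (heads \<xi>)))"
proof -
  have "map_instance q_ext (reduct E J) = map_instance q (reduct E J)"
    by (rule map_instance_cong) (simp add: q_ext_old_reduct terms_over_def)
  moreover have "map_instance q_ext (inst g' (heads \<xi>)) = inst h' (heads \<xi>)"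
  proof -
    have "map_instance q_ext (inst g' (heads \<xi>)) = inst (q_ext \<circ> g') (heads \<xi>)"
      using q_ext_Cst by (rule inst_comp[symmetric])
    also have "\<dots> = inst h' (heads \<xi>)"
      by (rule inst_cong) (simp add: q_ext_head)
    finally show ?thesis .
  qed
  ultimately show ?thesis
    by (simp add: reduct_fired map_instance_Un quotient_eq)
qed

lemma q_ext_eq_cases:
  assumes members: "s \<in> terms_over (reduct E J) \<union> g' ` evars \<xi>"
      "t \<in> terms_over (reduct E J) \<union> g' ` evars \<xi>"
    and eq: "q_ext s = q_ext t"
  shows "s = t \<or> (s \<in> terms_over (reduct E J) \<and> t \<in> terms_over (reduct E J) \<and> q s = q t)"
proof -
  have old: "q_ext u \<in> terms_over I" if "u \<in> terms_over (reduct E J)" for u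
    using that by (simp add: q_ext_old_reduct q_in)
  have new: "q_ext u \<in> h' ` evars \<xi>" if "u \<in> g' ` evars \<xi>" for u
    using that q_ext_fresh by auto
  show ?thesis
  proof (cases "s \<in> g' ` evars \<xi>")
    case True
    then have "t \<in> g' ` evars \<xi>"
      using members(2) old[of t] new[of s] eq fresh_nulls_disjoint(1) by auto
    moreover have "inj_on h' (evars \<xi>)"
      using fresh_I by (simp add: fresh_ext_def)
    ultimately have "s = t"
      using True eq q_ext_fresh by (auto dest: inj_onD)
    then show ?thesis ..
  next
    case False
    then have "s \<in> terms_over (reduct E J)"
      using members(1) by blast
    moreover from this have "t \<in> terms_over (reduct E J)"
      using members(2) old[of s] new[of t] eq fresh_nulls_disjoint(1) by auto
    ultimately show ?thesis
      using eq by (simp add: q_ext_old_reduct)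
  qed
qed

lemma E_quotient_fired: "E_quotient E (J \<union> inst g' (heads \<xi>)) (I \<union> inst h' (heads \<xi>)) q_ext e_ext"
proof
  let ?J = "J \<union> inst g' (heads \<xi>)" and ?I = "I \<union> inst h' (heads \<xi>)"
  show "q_ext (Cst c) = Cst c" for c by (rule q_ext_Cst)
  show "?I = map_instance q_ext (reduct E ?J)" by (rule quotient_fired)
  show "q_ext s = q_ext t" if "(s, t) \<in> Erel E ?J" for s t
  proof -
    have edge: "(s, t) \<in> Erel E J"
      using that Erel_fired by simp
    then show ?thesis
      using q_Erel[OF edge] Erel_in_adom[OF edge] by (simp add: q_ext_old terms_over_def)
  qed
  show "(s, t) \<in> (Erel E ?J)\<^sup>*"
    if "s \<in> terms_over (reduct E ?J)" "t \<in> terms_over (reduct E ?J)" "q_ext s = q_ext t" for s t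
    using q_ext_eq_cases[of s t] that connected[of s t]
    unfolding terms_over_fired Erel_fired by auto
  show "e_ext a \<in> terms_over (reduct E ?J)" if "a \<in> terms_over ?I" for a
    using that e_ext_old e_ext_fresh e_in unfolding terms_over_fired by auto
  show "q_ext (e_ext a) = a" if "a \<in> terms_over ?I" for a
    using that e_ext_old e_ext_fresh q_ext_fresh q_ext_old_reduct e_in q_e
    unfolding terms_over_fired by auto
qed

end

section \<open>The translated dependencies\<close>

definition egd_tgd :: "'r \<Rightarrow> ('r,'c) ratom list \<Rightarrow> nat \<Rightarrow> nat \<Rightarrow> ('r,'c) dep" where
  "egd_tgd E b x y = TGD b [(E, [RVar x, RVar y]), (E, [RVar y, RVar x])]"

lemma egd_tgd_simps [simp]:
  "is_tgd (egd_tgd E b x y)" "body (egd_tgd E b x y) = b"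
  "inst h (heads (egd_tgd E b x y)) = {(E, [h x, h y]), (E, [h y, h x])}"
  by (simp_all add: egd_tgd_def inst_def)

lemma is_trigger_egd_tgd [simp]: "is_trigger I (egd_tgd E b x y) h \<longleftrightarrow> is_trigger I (EGD b x y) h"
  by (simp add: is_trigger_def)

lemma evars_egd_tgd: "x \<in> avars b \<Longrightarrow> y \<in> avars b \<Longrightarrow> evars (egd_tgd E b x y) = {}"
  by (auto simp: evars_def egd_tgd_def avars_def)

lemma is_tgd_repl_rule [simp]: "is_tgd (repl_rule E R n i)"
  by (simp add: repl_rule_def)

lemma evars_repl_rule: "evars (repl_rule E R n i) = {}"
  by (auto simp: repl_rule_def evars_def avars_def split: if_splits)

lemma repl_rule_trigger_exists:
  assumes "length us = n" "i < n"
  shows "\<exists>h. inst h (body (repl_rule E R n i)) = {(E, [us ! i, t]), (R, us)}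
    \<and> inst h (heads (repl_rule E R n i)) = {(R, us[i := t])}"
proof -
  let ?h = "\<lambda>j. if j < n then us ! j else if j = n then us ! i else t"
  have "map (inst_t ?h) (map (\<lambda>j. if j = i then RVar n else RVar j) [0..<n]) = us"
    using assms by (intro nth_equalityI) auto
  moreover have
    "map (inst_t ?h) (map (\<lambda>j. if j = i then RVar (Suc n) else RVar j) [0..<n]) = us[i := t]"
    using assms by (intro nth_equalityI) (auto simp: nth_list_update)
  ultimately show ?thesis
    by (intro exI[of _ ?h]) (simp add: repl_rule_def inst_def del: map_map)
qed

lemma inst_heads_repl_rule_diagonal:
  assumes "h n = h (Suc n)"
  shows "inst h (heads (repl_rule E R n i)) \<subseteq> inst h (body (repl_rule E R n i))"
proof -
  have "map (inst_t h) (map (\<lambda>j. if j = i then RVar (Suc n) else RVar j) [0..<n]) =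
      map (inst_t h) (map (\<lambda>j. if j = i then RVar n else RVar j) [0..<n])"
    using assms by simp
  then show ?thesis
    by (simp add: repl_rule_def inst_def del: map_map)
qed

lemma sigma_tgd_tgd: "\<xi> \<in> \<Sigma> \<Longrightarrow> is_tgd \<xi> \<Longrightarrow> \<xi> \<in> sigma_tgd E ar \<Sigma>"
  and sigma_tgd_egd: "EGD b x y \<in> \<Sigma> \<Longrightarrow> egd_tgd E b x y \<in> sigma_tgd E ar \<Sigma>"
  and sigma_tgd_repl: "R \<in> rels_of \<Sigma> \<Longrightarrow> i < ar R \<Longrightarrow> repl_rule E R (ar R) i \<in> sigma_tgd E ar \<Sigma>"
  by (auto simp: sigma_tgd_def egd_tgd_def)

lemma sigma_tgd_cases:
  assumes "\<xi> \<in> sigma_tgd E ar \<Sigma>"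
  obtains (tgd) "\<xi> \<in> \<Sigma>" "is_tgd \<xi>"
  | (egd) b x y where "EGD b x y \<in> \<Sigma>" "\<xi> = egd_tgd E b x y"
  | (repl) R i where "R \<in> rels_of \<Sigma>" "i < ar R" "\<xi> = repl_rule E R (ar R) i"
  using assms unfolding sigma_tgd_def egd_tgd_def by blast

lemma is_tgd_sigma_tgd: "\<xi> \<in> sigma_tgd E ar \<Sigma> \<Longrightarrow> is_tgd \<xi>"
  by (auto elim: sigma_tgd_cases)

lemma finite_sigma_tgd:
  assumes "finite \<Sigma>"
  shows "finite (sigma_tgd E ar \<Sigma>)"
proof -
  have "rels_of \<Sigma> = (\<Union>\<xi>\<in>\<Sigma>. fst ` (set (body \<xi>) \<union> set (heads \<xi>)))"
    by (force simp: rels_of_def)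
  then have rels: "finite (rels_of \<Sigma>)"
    using assms by simp
  let ?tr = "\<lambda>\<xi>. case \<xi> of EGD b x y \<Rightarrow> egd_tgd E b x y | _ \<Rightarrow> \<xi>"
  have "sigma_tgd E ar \<Sigma> \<subseteq> \<Sigma> \<union> ?tr ` \<Sigma> \<union> (\<Union>R\<in>rels_of \<Sigma>. repl_rule E R (ar R) ` {..<ar R})"
    by (force elim: sigma_tgd_cases)
  then show ?thesis
    by (rule finite_subset) (simp add: assms rels)
qed

lemma rels_of_not_E:
  assumes "E \<notin> rels_of \<Sigma>" "\<xi> \<in> \<Sigma>"
  shows "E \<notin> fst ` set (body \<xi>)" "E \<notin> fst ` set (heads \<xi>)"
  using assms by (force simp: rels_of_def)+

lemma egd_tgd_notin: "E \<notin> rels_of \<Sigma> \<Longrightarrow> egd_tgd E b x y \<notin> \<Sigma>"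
  using rels_of_not_E(2) by (fastforce simp: egd_tgd_def)

lemma repl_rule_notin: "E \<notin> rels_of \<Sigma> \<Longrightarrow> repl_rule E R n i \<notin> \<Sigma>"
  using rels_of_not_E(1) by (fastforce simp: repl_rule_def)

lemma wf_dep_egd_vars: "wf_dep ar (EGD b x y) \<Longrightarrow> x \<in> avars b \<and> y \<in> avars b"
  by (simp add: wf_dep_def)

lemma unsaturated_repl_rule:
  assumes "\<not> saturated E ar \<R> J"
  obtains R us i t h where "R \<in> \<R>" "(R, us) \<in> J" "i < ar R" "length us = ar R"
    "(us ! i, t) \<in> Erel E J" "is_trigger J (repl_rule E R (ar R) i) h"
    "inst h (heads (repl_rule E R (ar R) i)) = {(R, us[i := t])}" "(R, us[i := t]) \<notin> J"
proof -
  obtain R us i t where atom: "R \<in> \<R>" "(R, us) \<in> J" "length us = ar R" "i < ar R"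
      "(us ! i, t) \<in> Erel E J" "(R, us[i := t]) \<notin> J"
    using assms by (auto simp: saturated_def)
  obtain h where instances:
      "inst h (body (repl_rule E R (ar R) i)) = {(E, [us ! i, t]), (R, us)}"
      "inst h (heads (repl_rule E R (ar R) i)) = {(R, us[i := t])}"
    using repl_rule_trigger_exists[OF atom(3,4), of E R t] by blast
  have "is_trigger J (repl_rule E R (ar R) i) h"
    using instances(1) atom(2,5) by (simp add: is_trigger_def Erel_def)
  then show thesis
    using that atom instances(2) by blast
qed

locale dependencies =
  fixes \<Sigma> :: "('r,'c) dep set" and ar :: "'r \<Rightarrow> nat" and E :: 'r
  assumes finite_\<Sigma>: "finite \<Sigma>"
    and wf: "\<xi> \<in> \<Sigma> \<Longrightarrow> wf_dep ar \<xi>"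
    and E_new: "E \<notin> rels_of \<Sigma>"
begin

abbreviation \<Sigma>t :: "('r,'c) dep set" where
  "\<Sigma>t \<equiv> sigma_tgd E ar \<Sigma>"

lemmas body_not_E = rels_of_not_E(1)[OF E_new]
  and heads_not_E = rels_of_not_E(2)[OF E_new]

lemma egd_vars: "EGD b x y \<in> \<Sigma> \<Longrightarrow> x \<in> avars b" "EGD b x y \<in> \<Sigma> \<Longrightarrow> y \<in> avars b"
  using wf wf_dep_egd_vars by blast+

end

locale dependencies_quotient = dependencies \<Sigma> ar E + E_quotient E J I q e
  for \<Sigma> :: "('r,'c) dep set" and ar :: "'r \<Rightarrow> nat" and E :: 'r and J I :: "('r,'c) atom set"
    and q e :: "'c trm \<Rightarrow> 'c trm"
begin

lemma lift_trigger:
  assumes "saturated E ar (rels_of \<Sigma>) J" "\<xi> \<in> \<Sigma>" "is_trigger I \<xi> h"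
  shows "is_trigger J \<xi> (e \<circ> h)"
  unfolding is_trigger_def
proof (rule lift_conjunction[OF assms(1)])
  fix R ts assume "(R, ts) \<in> set (body \<xi>)"
  then show "R \<in> rels_of \<Sigma> \<and> length ts = ar R"
    using assms(2) wf[OF assms(2)] by (auto simp: rels_of_def wf_dep_def)
qed (use assms(3) in \<open>simp add: is_trigger_def\<close>)

lemma project_head_satisfied:
  assumes \<xi>: "\<xi> \<in> \<Sigma>" and trigger: "is_trigger I \<xi> h" and sat: "head_satisfied J \<xi> (e \<circ> h)"
  shows "head_satisfied I \<xi> h"
proof -
  have "head_satisfied (reduct E J) \<xi> (e \<circ> h)"
    using sat heads_not_E[OF \<xi>] by (simp add: head_satisfied_reduct_iff)
  then have "head_satisfied I \<xi> (q \<circ> (e \<circ> h))"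
    by (rule head_satisfied_hom[OF hom_q])
  moreover have "(q \<circ> (e \<circ> h)) v = h v" if "v \<in> bvars \<xi>" for v
    using trigger_in_terms_over[OF trigger] that q_e by auto
  ultimately show ?thesis
    using head_satisfied_cong by metis
qed

end

section \<open>Termination\<close>

lemma accp_iff_no_infinite_chain:
  "Wellfounded.accp r x \<longleftrightarrow> \<not> (\<exists>f :: nat \<Rightarrow> _. f 0 = x \<and> (\<forall>n. r (f (Suc n)) (f n)))"
proof
  assume "Wellfounded.accp r x"
  then have "x \<notin> range f" if "\<forall>n. r (f (Suc n)) (f n)" for f :: "nat \<Rightarrow> _"
    using that by (induction rule: accp.induct) blast
  then show "\<not> (\<exists>f :: nat \<Rightarrow> _. f 0 = x \<and> (\<forall>n. r (f (Suc n)) (f n)))"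
    by blast
next
  assume no_chain: "\<not> (\<exists>f :: nat \<Rightarrow> _. f 0 = x \<and> (\<forall>n. r (f (Suc n)) (f n)))"
  show "Wellfounded.accp r x"
  proof (rule ccontr)
    assume "\<not> Wellfounded.accp r x"
    then have "\<exists>f :: nat \<Rightarrow> _. \<forall>n. (\<not> Wellfounded.accp r (f n) \<and> (n = 0 \<longrightarrow> f n = x)) \<and>
        r (f (Suc n)) (f n)"
      by (intro dependent_nat_choice) (auto elim: not_accp_down)
    then show False
      using no_chain by blast
  qed
qed

abbreviation terminating :: "variant \<Rightarrow> ('r,'c) dep set \<Rightarrow> ('r,'c) config \<Rightarrow> bool" where
  "terminating v \<Sigma> \<equiv> Wellfounded.accp (\<lambda>y x. step v \<Sigma> x y)"

lemma terminates_iff_terminating: "terminates v \<Sigma> I \<longleftrightarrow> terminating v \<Sigma> (Inst I, {})"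
  by (simp add: terminates_def accp_iff_no_infinite_chain)

lemma accp_stuttering_simulation:
  fixes m :: "'b \<Rightarrow> nat"
  assumes "Wellfounded.accp r c" "Q c a"
    and sim: "\<And>c a. Q c a \<Longrightarrow> (\<exists>c'. r c' c \<and> Q c' a) \<or>
      (\<forall>a'. s a' a \<longrightarrow> Wellfounded.accp s a' \<or> (Q c a' \<and> m a' < m a) \<or> (\<exists>c'. r c' c \<and> Q c' a'))"
  shows "Wellfounded.accp s a"
  using assms(1,2)
proof (induction arbitrary: a rule: accp.induct)
  case (accI c)
  note later = accI.IH
  show ?case
    using accI.prems
  proof (induction "m a" arbitrary: a rule: less_induct)
    case less
    from sim[OF less.prems] show ?case
    proof
      assume "\<exists>c'. r c' c \<and> Q c' a"
      then show ?thesis using later by blast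
    next
      assume "\<forall>a'. s a' a \<longrightarrow>
        Wellfounded.accp s a' \<or> (Q c a' \<and> m a' < m a) \<or> (\<exists>c'. r c' c \<and> Q c' a')"
      then show ?thesis
        using later less.hyps by (blast intro: accpI)
    qed
  qed
qed

section \<open>The standard, oblivious and semi-oblivious chase\<close>

type_synonym ('r,'c) trigger_log = "(('r,'c) dep \<times> (nat \<Rightarrow> 'c trm option)) set"

definition log_vars :: "variant \<Rightarrow> ('r,'c) dep \<Rightarrow> nat set" where
  "log_vars v \<xi> = (if v = Obl then bvars \<xi> else key_vars \<xi>)"

definition trigger_key :: "variant \<Rightarrow> ('r,'c) dep \<Rightarrow> (nat \<Rightarrow> 'c trm) \<Rightarrow>
    ('r,'c) dep \<times> (nat \<Rightarrow> 'c trm option)" where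
  "trigger_key v \<xi> h = (\<xi>, restr h (log_vars v \<xi>))"

definition applicable :: "variant \<Rightarrow> ('r,'c) atom set \<Rightarrow> ('r,'c) trigger_log \<Rightarrow>
    ('r,'c) dep \<Rightarrow> (nat \<Rightarrow> 'c trm) \<Rightarrow> bool" where
  "applicable v I H \<xi> h \<longleftrightarrow> (if v = Std then active I \<xi> h else trigger_key v \<xi> h \<notin> H)"

definition log_trigger :: "variant \<Rightarrow> ('r,'c) trigger_log \<Rightarrow>
    ('r,'c) dep \<Rightarrow> (nat \<Rightarrow> 'c trm) \<Rightarrow> ('r,'c) trigger_log" where
  "log_trigger v H \<xi> h = (if v = Std then H else insert (trigger_key v \<xi> h) H)"

lemma trigger_key_eq_iff:
  "trigger_key v \<xi> h = trigger_key v \<zeta> k \<longleftrightarrow> \<xi> = \<zeta> \<and> (\<forall>x\<in>log_vars v \<xi>. h x = k x)"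
  by (auto simp: trigger_key_def restr_eq_iff)

lemma log_vars_subset_bvars: "log_vars v \<xi> \<subseteq> bvars \<xi>"
  by (cases \<xi>) (auto simp: log_vars_def bvars_def)

lemma avars_heads_subset_log_vars: "evars \<xi> = {} \<Longrightarrow> avars (heads \<xi>) \<subseteq> log_vars v \<xi>"
  by (cases \<xi>) (auto simp: log_vars_def bvars_def evars_def avars_def)

lemma log_trigger_mono: "H \<subseteq> log_trigger v H \<xi> h"
  by (auto simp: log_trigger_def)

lemma log_triggerE:
  assumes "trigger_key v \<zeta> k \<in> log_trigger v G \<xi> h"
  obtains (old) "trigger_key v \<zeta> k \<in> G"
  | (new) "v \<noteq> Std" "\<zeta> = \<xi>" "\<And>x. x \<in> log_vars v \<xi> \<Longrightarrow> k x = h x"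
  using assms by (auto simp: log_trigger_def trigger_key_eq_iff split: if_splits)

lemma step_iff_applicable:
  assumes "v \<noteq> CoreV"
  shows "step v \<Sigma> (Inst I, H) (S', H') \<longleftrightarrow>
    (\<exists>\<xi>\<in>\<Sigma>. \<exists>h. is_trigger I \<xi> h \<and> applicable v I H \<xi> h \<and> fire I \<xi> h S' \<and> H' = log_trigger v H \<xi> h)"
  using assms by (cases v) (auto simp: applicable_def log_trigger_def trigger_key_def log_vars_def)

lemma fire_tgd_iff:
  "is_tgd \<xi> \<Longrightarrow> fire I \<xi> h S \<longleftrightarrow> (\<exists>h'. fresh_ext I \<xi> h h' \<and> S = Inst (I \<union> inst h' (heads \<xi>)))"
  by (cases \<xi>) auto

lemma step_tgd:
  assumes "v \<noteq> CoreV" "\<xi> \<in> \<Sigma>" "is_tgd \<xi>" "is_trigger I \<xi> h" "applicable v I H \<xi> h"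
    and "fresh_ext I \<xi> h h'"
  shows "step v \<Sigma> (Inst I, H) (Inst (I \<union> inst h' (heads \<xi>)), log_trigger v H \<xi> h)"
  unfolding step_iff_applicable[OF assms(1)] using assms(2-) fire_tgd_iff by blast

lemma egd_result_cases:
  assumes "s \<noteq> t"
  obtains (fail) "egd_result I s t = Fail"
  | (merge) n w where "egd_result I s t = Inst (replace (Nul n) w I)"
      "{Nul n, w} = {s, t}" "w \<noteq> Nul n"
proof (cases s)
  case (Cst c)
  then show ?thesis
    using assms that by (cases t) auto
next
  case s: (Nul m)
  show ?thesis
  proof (cases t)
    case (Cst d)
    then show ?thesis
      using s merge[of m "Cst d"] by auto
  next
    case (Nul k)
    then show ?thesis
      using s assms merge[of "max m k" "Nul (min m k)"]
      by (cases "m \<le> k") (auto simp: max_def min_def)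
  qed
qed

lemma egd_result_same: "egd_result I s s = Inst I"
proof -
  have "replace s s I = I"
    by (simp add: replace_eq_map_instance map_instance_ident)
  then show ?thesis
    by (cases s) auto
qed

definition log_sound :: "variant \<Rightarrow> ('r,'c) atom set \<Rightarrow> ('r,'c) trigger_log \<Rightarrow> bool" where
  "log_sound v J G \<longleftrightarrow> (\<forall>\<xi> h. trigger_key v \<xi> h \<in> G \<longrightarrow>
     h ` log_vars v \<xi> \<subseteq> terms_over J \<and> (evars \<xi> = {} \<longrightarrow> inst h (heads \<xi>) \<subseteq> J))"

lemma log_sound_empty: "log_sound v J {}"
  by (simp add: log_sound_def)

lemma log_sound_terms: "log_sound v J G \<Longrightarrow> trigger_key v \<xi> h \<in> G \<Longrightarrow> h ` log_vars v \<xi> \<subseteq> terms_over J"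
  by (simp add: log_sound_def)

lemma trigger_log_vars_in: "is_trigger J \<xi> g \<Longrightarrow> g ` log_vars v \<xi> \<subseteq> terms_over J"
  by (rule subset_trans[OF image_mono[OF log_vars_subset_bvars] trigger_in_terms_over])

lemma log_sound_log_trigger:
  assumes sound: "log_sound v J G" and trigger: "is_trigger J \<xi> g"
    and extends: "\<And>x. x \<in> bvars \<xi> \<Longrightarrow> g' x = g x"
  shows "log_sound v (J \<union> inst g' (heads \<xi>)) (log_trigger v G \<xi> g)"
  unfolding log_sound_def
proof (intro allI impI)
  fix \<zeta> k assume "trigger_key v \<zeta> k \<in> log_trigger v G \<xi> g"
  then show "k ` log_vars v \<zeta> \<subseteq> terms_over (J \<union> inst g' (heads \<xi>)) \<and>
      (evars \<zeta> = {} \<longrightarrow> inst k (heads \<zeta>) \<subseteq> J \<union> inst g' (heads \<xi>))"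
  proof (cases rule: log_triggerE)
    case old
    then show ?thesis
      using sound unfolding log_sound_def terms_over_Un by blast
  next
    case new
    have "k ` log_vars v \<xi> = g ` log_vars v \<xi>"
      using new(3) by simp
    moreover have "inst k (heads \<xi>) = inst g' (heads \<xi>)" if "evars \<xi> = {}"
      using avars_heads_subset_log_vars[OF that, of v] new(3) extends log_vars_subset_bvars[of v \<xi>]
      by (intro inst_cong) (metis subsetD)
    ultimately show ?thesis
      using trigger_log_vars_in[OF trigger, of v] new(2) by (simp add: terms_over_Un le_supI1)
  qed
qed

lemma applicable_full:
  assumes "log_sound v J G" "is_tgd \<xi>" "evars \<xi> = {}" "\<not> inst g (heads \<xi>) \<subseteq> J"
  shows "applicable v J G \<xi> g"
  using assms unfolding applicable_def log_sound_def
  by (auto simp: active_iff_not_head_satisfied head_satisfied_full_iff)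

text \<open>The name of a merged null may be reused for a fresh null, which is why \<open>e\<close> need not be the
  identity.\<close>
locale simulation = dependencies_quotient \<Sigma> ar E J I q e
  for \<Sigma> :: "('r,'c) dep set" and ar :: "'r \<Rightarrow> nat" and E :: 'r and J I :: "('r,'c) atom set"
    and q e :: "'c trm \<Rightarrow> 'c trm" +
  fixes v :: variant and G H :: "('r,'c) trigger_log"
  assumes not_core: "v \<noteq> CoreV"
    and finite_J: "finite J"
    and sound: "log_sound v J G"
    and logged: "\<xi> \<in> \<Sigma> \<Longrightarrow> h ` log_vars v \<xi> \<subseteq> terms_over I \<Longrightarrow> trigger_key v \<xi> (e \<circ> h) \<in> G \<Longrightarrow>
      trigger_key v \<xi> h \<in> H"
begin

lemma finite_I: "finite I"
  unfolding quotient_eq using finite_J reduct_subset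
  by (intro finite_map_instance) (rule finite_subset)

lemma simulate_full:
  assumes \<xi>: "\<xi> \<in> \<Sigma>t" "\<xi> \<notin> \<Sigma>" and full: "evars \<xi> = {}"
    and trigger: "is_trigger J \<xi> g" and unsat: "\<not> inst g (heads \<xi>) \<subseteq> J"
    and quotient: "E_quotient E (J \<union> inst g (heads \<xi>)) I' q' e"
    and shrinks: "terms_over I' \<subseteq> terms_over I" and log: "H \<subseteq> H'"
  shows "\<exists>J' G'. step v \<Sigma>t (Inst J, G) (Inst J', G') \<and> simulation \<Sigma> ar E J' I' q' e v G' H'"
proof -
  let ?J = "J \<union> inst g (heads \<xi>)" and ?G = "log_trigger v G \<xi> g"
  have tgd: "is_tgd \<xi>"
    using \<xi>(1) by (rule is_tgd_sigma_tgd)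
  have "applicable v J G \<xi> g"
    using sound tgd full unsat by (rule applicable_full)
  then have "step v \<Sigma>t (Inst J, G) (Inst ?J, ?G)"
    using not_core \<xi>(1) tgd trigger fresh_ext_refl[OF full] by (intro step_tgd)
  moreover have "simulation \<Sigma> ar E ?J I' q' e v ?G H'"
  proof (intro simulation.intro simulation_axioms.intro dependencies_quotient.intro
      dependencies_axioms quotient)
    show "v \<noteq> CoreV" by (rule not_core)
    show "finite ?J" using finite_J by (simp add: finite_inst)
    show "log_sound v ?J ?G"
      using sound trigger by (rule log_sound_log_trigger) simp
    show "trigger_key v \<zeta> h \<in> H'"
      if "\<zeta> \<in> \<Sigma>" "h ` log_vars v \<zeta> \<subseteq> terms_over I'" "trigger_key v \<zeta> (e \<circ> h) \<in> ?G" for \<zeta> h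
      using that(3)
    proof (cases rule: log_triggerE)
      case old
      then show ?thesis using logged that shrinks log by blast
    next
      case new
      then show ?thesis using that(1) \<xi>(2) by simp
    qed
  qed
  ultimately show ?thesis by blast
qed

lemma simulate_congruence:
  assumes "\<not> saturated E ar (rels_of \<Sigma>) J"
  shows "\<exists>J' G'. step v \<Sigma>t (Inst J, G) (Inst J', G') \<and> simulation \<Sigma> ar E J' I q e v G' H"
proof -
  obtain R us i t g where rule_in: "R \<in> rels_of \<Sigma>" "i < ar R"
    and atom: "(R, us) \<in> J" "length us = ar R" "(us ! i, t) \<in> Erel E J"
    and trigger: "is_trigger J (repl_rule E R (ar R) i) g"
    and head: "inst g (heads (repl_rule E R (ar R) i)) = {(R, us[i := t])}"
    and unsat: "(R, us[i := t]) \<notin> J"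
    using assms by (rule unsaturated_repl_rule)
  have "R \<noteq> E"
    using rule_in(1) E_new by blast
  then have "E_quotient E (J \<union> {(R, us[i := t])}) I q e"
    using rule_in(2) atom by (intro E_quotient_congruent_atom) simp_all
  then show ?thesis
    using simulate_full[OF sigma_tgd_repl[where ar = ar, OF rule_in] repl_rule_notin[OF E_new]
        evars_repl_rule trigger] head unsat by simp
qed

lemma simulate_merge:
  assumes sat: "saturated E ar (rels_of \<Sigma>) J"
    and egd: "EGD b x y \<in> \<Sigma>" and trigger: "is_trigger I (EGD b x y) h"
    and merge: "{Nul n, w} = {h x, h y}" "w \<noteq> Nul n" and log: "H \<subseteq> H'"
  shows "\<exists>J' G' q'. step v \<Sigma>t (Inst J, G) (Inst J', G') \<and>
    simulation \<Sigma> ar E J' (replace (Nul n) w I) q' e v G' H'"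
proof -
  let ?g = "e \<circ> h" and ?I = "replace (Nul n) w I" and ?\<xi> = "egd_tgd E b x y"
  have lifted: "is_trigger J ?\<xi> ?g"
    using lift_trigger[OF sat egd trigger] by simp
  have endpoints: "h x \<in> terms_over I" "h y \<in> terms_over I"
    using trigger_in_terms_over[OF trigger] egd_vars[OF egd] by (auto simp: bvars_def)
  then have "q (?g x) \<noteq> q (?g y)"
    using q_e merge by auto
  then have "(?g x, ?g y) \<notin> Erel E J"
    using q_Erel by blast
  then have unsat: "\<not> inst ?g (heads ?\<xi>) \<subseteq> J"
    by (simp add: Erel_def)
  have "E_quotient E (J \<union> inst ?g (heads ?\<xi>)) ?I (id(Nul n := w) \<circ> q) e"
    using E_quotient_merged[of "?g x" "?g y" n w] merge endpoints e_in q_e by simp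
  moreover have "{Nul n, w} \<subseteq> terms_over I"
    using merge(1) endpoints by simp
  then have "terms_over ?I \<subseteq> terms_over I"
    using terms_over_merged[OF _ merge(2)] by blast
  ultimately show ?thesis
    using simulate_full[OF sigma_tgd_egd[OF egd] egd_tgd_notin[OF E_new]
        evars_egd_tgd[OF egd_vars[OF egd]] lifted unsat] log by blast
qed

lemma lift_applicable:
  assumes "\<xi> \<in> \<Sigma>" "is_tgd \<xi>" "is_trigger I \<xi> h" "applicable v I H \<xi> h"
  shows "applicable v J G \<xi> (e \<circ> h)"
proof (cases "v = Std")
  case True
  then show ?thesis
    using assms project_head_satisfied
    by (auto simp: applicable_def active_iff_not_head_satisfied)
next
  case False
  then show ?thesis
    using assms(4) logged[OF assms(1) trigger_log_vars_in[OF assms(3)]]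
    by (auto simp: applicable_def)
qed

lemma simulation_log_mono:
  assumes "H \<subseteq> H'"
  shows "simulation \<Sigma> ar E J I q e v G H'"
  using assms logged by unfold_locales (use not_core finite_J sound in auto)

end

locale simulation_tgd = simulation \<Sigma> ar E J I q e v G H + E_quotient_tgd E J I q e \<xi> h h' g'
  for \<Sigma> :: "('r,'c) dep set" and ar :: "'r \<Rightarrow> nat" and E :: 'r and J I :: "('r,'c) atom set"
    and q e :: "'c trm \<Rightarrow> 'c trm" and v :: variant and G H :: "('r,'c) trigger_log"
    and \<xi> :: "('r,'c) dep" and h h' g' :: "nat \<Rightarrow> 'c trm" +
  assumes lifted_trigger: "is_trigger J \<xi> (e \<circ> h)"
begin

lemma logged_old_terms:
  assumes key: "trigger_key v \<zeta> (e_ext \<circ> k) \<in> log_trigger v G \<xi> (e \<circ> h)"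
    and key_terms: "k ` log_vars v \<zeta> \<subseteq> terms_over (I \<union> inst h' (heads \<xi>))"
    and log_var: "x \<in> log_vars v \<zeta>"
  shows "k x \<in> terms_over I"
proof -
  have "(e_ext \<circ> k) ` log_vars v \<zeta> \<subseteq> terms_over J"
    using key
  proof (cases rule: log_triggerE)
    case old
    then show ?thesis by (rule log_sound_terms[OF sound])
  next
    case new
    then show ?thesis using trigger_log_vars_in[OF lifted_trigger] by (metis image_cong)
  qed
  then show ?thesis
    using log_var key_terms e_ext_fresh fresh_nulls_disjoint(2) unfolding terms_over_fired by force
qed

lemma logged_fired:
  assumes \<zeta>: "\<zeta> \<in> \<Sigma>" and key_terms: "k ` log_vars v \<zeta> \<subseteq> terms_over (I \<union> inst h' (heads \<xi>))"
    and key: "trigger_key v \<zeta> (e_ext \<circ> k) \<in> log_trigger v G \<xi> (e \<circ> h)"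
  shows "trigger_key v \<zeta> k \<in> log_trigger v H \<xi> h"
proof -
  have old_terms: "k x \<in> terms_over I" if "x \<in> log_vars v \<zeta>" for x
    using key key_terms that by (rule logged_old_terms)
  show ?thesis
    using key
  proof (cases rule: log_triggerE)
    case old
    moreover have "trigger_key v \<zeta> (e_ext \<circ> k) = trigger_key v \<zeta> (e \<circ> k)"
      using old_terms e_ext_old by (simp add: trigger_key_eq_iff)
    ultimately have "trigger_key v \<zeta> k \<in> H"
      using logged[OF \<zeta>] old_terms by (metis image_subsetI)
    then show ?thesis
      using log_trigger_mono by blast
  next
    case new
    have "k x = h x" if "x \<in> log_vars v \<xi>" for x
    proof (rule inj_onD[OF inj_on_e])
      show "e (k x) = e (h x)"
        using new(2,3) that old_terms e_ext_old by simp
      show "k x \<in> terms_over I" "h x \<in> terms_over I"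
        using new(2) that old_terms trigger_log_vars_in[OF trigger, of v] by auto
    qed
    then have "trigger_key v \<zeta> k = trigger_key v \<xi> h"
      using new(2) by (simp add: trigger_key_eq_iff)
    then show ?thesis using new(1) by (simp add: log_trigger_def)
  qed
qed

lemma simulation_fired:
  "simulation \<Sigma> ar E (J \<union> inst g' (heads \<xi>)) (I \<union> inst h' (heads \<xi>)) q_ext e_ext v
     (log_trigger v G \<xi> (e \<circ> h)) (log_trigger v H \<xi> h)"
proof (intro simulation.intro simulation_axioms.intro dependencies_quotient.intro
    dependencies_axioms E_quotient_fired)
  show "v \<noteq> CoreV" by (rule not_core)
  show "finite (J \<union> inst g' (heads \<xi>))" using finite_J by (simp add: finite_inst)
  show "log_sound v (J \<union> inst g' (heads \<xi>)) (log_trigger v G \<xi> (e \<circ> h))"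
    using sound lifted_trigger fresh_J by (intro log_sound_log_trigger) (auto simp: fresh_ext_def)
qed (rule logged_fired)

end

context simulation
begin

lemma simulate_tgd:
  assumes sat: "saturated E ar (rels_of \<Sigma>) J" and \<xi>: "\<xi> \<in> \<Sigma>" "is_tgd \<xi>"
    and trigger: "is_trigger I \<xi> h" "applicable v I H \<xi> h" and fresh: "fresh_ext I \<xi> h h'"
  shows "\<exists>J' G' q' e'. step v \<Sigma>t (Inst J, G) (Inst J', G') \<and>
    simulation \<Sigma> ar E J' (I \<union> inst h' (heads \<xi>)) q' e' v G' (log_trigger v H \<xi> h)"
proof -
  have lifted: "is_trigger J \<xi> (e \<circ> h)"
    using sat \<xi>(1) trigger(1) by (rule lift_trigger)
  obtain g' where fresh_lifted: "fresh_ext J \<xi> (e \<circ> h) g'"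
    using fresh_ext_exists[OF finite_J] by blast
  have "step v \<Sigma>t (Inst J, G) (Inst (J \<union> inst g' (heads \<xi>)), log_trigger v G \<xi> (e \<circ> h))"
    by (rule step_tgd[OF not_core sigma_tgd_tgd[OF \<xi>] \<xi>(2) lifted lift_applicable[OF \<xi> trigger]
          fresh_lifted])
  moreover have fired: "simulation_tgd \<Sigma> ar E J I q e v G H \<xi> h h' g'"
    using heads_not_E[OF \<xi>(1)] trigger(1) fresh fresh_lifted lifted by unfold_locales
  ultimately show ?thesis
    using simulation_tgd.simulation_fired[OF fired] by blast
qed

lemma simulate_egd:
  assumes sat: "saturated E ar (rels_of \<Sigma>) J" and egd: "EGD b x y \<in> \<Sigma>"
    and trigger: "is_trigger I (EGD b x y) h" "applicable v I H (EGD b x y) h"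
    and log: "H' = log_trigger v H (EGD b x y) h"
  obtains (fail) "egd_result I (h x) (h y) = Fail"
  | (trivial) "egd_result I (h x) (h y) = Inst I" "trigger_key v (EGD b x y) h \<in> H' - H"
      "simulation \<Sigma> ar E J I q e v G H'"
  | (merge) J' G' I' q' where "egd_result I (h x) (h y) = Inst I'"
      "step v \<Sigma>t (Inst J, G) (Inst J', G')" "simulation \<Sigma> ar E J' I' q' e v G' H'"
proof (cases "h x = h y")
  case True
  then have "trigger_key v (EGD b x y) h \<in> H' - H"
    using trigger(2) by (auto simp: log applicable_def log_trigger_def split: if_splits)
  moreover have "simulation \<Sigma> ar E J I q e v G H'"
    unfolding log by (rule simulation_log_mono[OF log_trigger_mono])
  ultimately show thesis
    using trivial True egd_result_same by metis
next
  case False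
  then show thesis
  proof (cases rule: egd_result_cases[of "h x" "h y" I])
    case fail
    then show thesis by (rule that(1))
  next
    case (merge n w)
    have "H \<subseteq> H'"
      unfolding log by (rule log_trigger_mono)
    then show thesis
      using simulate_merge[OF sat egd trigger(1) merge(2,3)] that(3)[OF merge(1)] by blast
  qed
qed

end

definition pending_triggers :: "variant \<Rightarrow> ('r,'c) dep set \<Rightarrow> ('r,'c) config \<Rightarrow>
    ('r,'c) trigger_log" where
  "pending_triggers v \<Sigma> a = (case a of
     (Inst I, H) \<Rightarrow> {trigger_key v \<xi> h | \<xi> h. \<xi> \<in> \<Sigma> \<and> is_trigger I \<xi> h} - H
   | (Fail, _) \<Rightarrow> {})"

lemma card_pending_triggers_less:
  assumes "finite \<Sigma>" "finite I" "\<xi> \<in> \<Sigma>" "is_trigger I \<xi> h" "trigger_key v \<xi> h \<in> H' - H" "H \<subseteq> H'"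
  shows "card (pending_triggers v \<Sigma> (Inst I, H')) < card (pending_triggers v \<Sigma> (Inst I, H))"
proof (rule psubset_card_mono)
  show "finite (pending_triggers v \<Sigma> (Inst I, H))"
    using finite_trigger_keys[OF assms(1,2) log_vars_subset_bvars]
    by (simp add: pending_triggers_def trigger_key_def)
  have "trigger_key v \<xi> h \<in> pending_triggers v \<Sigma> (Inst I, H) - pending_triggers v \<Sigma> (Inst I, H')"
    using assms(3-5) by (auto simp: pending_triggers_def)
  then show "pending_triggers v \<Sigma> (Inst I, H') \<subset> pending_triggers v \<Sigma> (Inst I, H)"
    using assms(6) by (auto simp: pending_triggers_def)
qed

context dependencies
begin

definition simulates :: "variant \<Rightarrow> ('r,'c) config \<Rightarrow> ('r,'c) config \<Rightarrow> bool" where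
  "simulates v c a \<longleftrightarrow>
     (\<exists>J I q e G H. c = (Inst J, G) \<and> a = (Inst I, H) \<and> simulation \<Sigma> ar E J I q e v G H)"

definition step_matched :: "variant \<Rightarrow> ('r,'c) config \<Rightarrow> ('r,'c) config \<Rightarrow> ('r,'c) config \<Rightarrow> bool" where
  "step_matched v c a a' \<longleftrightarrow> terminating v \<Sigma> a'
     \<or> simulates v c a' \<and> card (pending_triggers v \<Sigma> a') < card (pending_triggers v \<Sigma> a)
     \<or> (\<exists>c'. step v \<Sigma>t c c' \<and> simulates v c' a')"

lemma simulatesI: "simulation \<Sigma> ar E J I q e v G H \<Longrightarrow> simulates v (Inst J, G) (Inst I, H)"
  unfolding simulates_def by blast

lemma egd_step_matched:
  assumes sim: "simulation \<Sigma> ar E J I q e v G H" and sat: "saturated E ar (rels_of \<Sigma>) J"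
    and egd: "EGD b x y \<in> \<Sigma>"
    and trigger: "is_trigger I (EGD b x y) h" "applicable v I H (EGD b x y) h"
    and log: "H' = log_trigger v H (EGD b x y) h"
  shows "step_matched v (Inst J, G) (Inst I, H) (egd_result I (h x) (h y), H')"
proof -
  interpret simulation \<Sigma> ar E J I q e v G H by (rule sim)
  show ?thesis
    using sat egd trigger log
  proof (cases rule: simulate_egd)
    case fail
    then show ?thesis
      unfolding step_matched_def by (auto intro: accpI)
  next
    case trivial
    have "H \<subseteq> H'"
      unfolding log by (rule log_trigger_mono)
    then have "card (pending_triggers v \<Sigma> (Inst I, H')) < card (pending_triggers v \<Sigma> (Inst I, H))"
      using finite_\<Sigma> finite_I egd trigger(1) trivial(2) by (intro card_pending_triggers_less)
    then show ?thesis
      using simulatesI[OF trivial(3)] unfolding step_matched_def trivial(1) by blast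
  next
    case merge
    then show ?thesis
      using simulatesI unfolding step_matched_def by metis
  qed
qed

lemma saturated_step_matched:
  assumes sim: "simulation \<Sigma> ar E J I q e v G H" and sat: "saturated E ar (rels_of \<Sigma>) J"
    and step: "step v \<Sigma> (Inst I, H) (S', H')"
  shows "step_matched v (Inst J, G) (Inst I, H) (S', H')"
proof -
  interpret simulation \<Sigma> ar E J I q e v G H by (rule sim)
  obtain \<xi> h where \<xi>: "\<xi> \<in> \<Sigma>" and trigger: "is_trigger I \<xi> h" "applicable v I H \<xi> h"
    and fire: "fire I \<xi> h S'" and log: "H' = log_trigger v H \<xi> h"
    using step step_iff_applicable[OF not_core] by blast
  show ?thesis
  proof (cases \<xi>)
    case (TGD b hs)
    then have tgd: "is_tgd \<xi>" by simp
    obtain h' where fresh: "fresh_ext I \<xi> h h'" and result: "S' = Inst (I \<union> inst h' (heads \<xi>))"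
      using fire fire_tgd_iff[OF tgd] by blast
    show ?thesis
      using simulate_tgd[OF sat \<xi> tgd trigger fresh] simulatesI
      unfolding step_matched_def result log by blast
  next
    case (EGD b x y)
    then have "S' = egd_result I (h x) (h y)"
      using fire by simp
    then show ?thesis
      using egd_step_matched[OF sim sat] \<xi> trigger log unfolding EGD by simp
  qed
qed

lemma terminating_simulation:
  assumes "terminating v \<Sigma>t (Inst J, G)" "simulation \<Sigma> ar E J I q e v G H"
  shows "terminating v \<Sigma> (Inst I, H)"
  using assms(1) simulatesI[OF assms(2)]
proof (rule accp_stuttering_simulation[where m = "\<lambda>a. card (pending_triggers v \<Sigma> a)"])
  fix c a assume "simulates v c a"
  then obtain J I q e G H where upper: "c = (Inst J, G)" and lower: "a = (Inst I, H)"
    and sim: "simulation \<Sigma> ar E J I q e v G H"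
    unfolding simulates_def by blast
  have "(\<exists>c'. step v \<Sigma>t c c' \<and> simulates v c' a) \<or> (\<forall>a'. step v \<Sigma> a a' \<longrightarrow> step_matched v c a a')"
  proof (cases "saturated E ar (rels_of \<Sigma>) J")
    case False
    then show ?thesis
      using simulation.simulate_congruence[OF sim] simulatesI unfolding upper lower by meson
  next
    case True
    then show ?thesis
      using saturated_step_matched[OF sim] unfolding upper lower by auto
  qed
  then show "(\<exists>c'. step v \<Sigma>t c c' \<and> simulates v c' a) \<or>
      (\<forall>a'. step v \<Sigma> a a' \<longrightarrow> terminating v \<Sigma> a' \<or>
        (simulates v c a' \<and> card (pending_triggers v \<Sigma> a') < card (pending_triggers v \<Sigma> a)) \<or>
        (\<exists>c'. step v \<Sigma>t c c' \<and> simulates v c' a'))"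
    unfolding step_matched_def .
qed

lemma terminates_non_core:
  assumes not_core: "v \<noteq> CoreV" and start: "finite I" "E \<notin> fst ` I"
    and tgd_chase: "terminates v \<Sigma>t I"
  shows "terminates v \<Sigma> I"
proof -
  have "Erel E I = {}"
    using start(2) by (force simp: Erel_def)
  then have "simulation \<Sigma> ar E I I id id v {} {}"
    using not_core start
    by unfold_locales (simp_all add: reduct_ident map_instance_ident log_sound_empty)
  then show ?thesis
    using tgd_chase terminating_simulation unfolding terminates_iff_terminating by blast
qed

end

section \<open>Parallel firing\<close>

definition active_keys :: "('r,'c) dep set \<Rightarrow> ('r,'c) atom set \<Rightarrow> ('r,'c) trigger_log" where
  "active_keys \<Sigma> I =
     {(\<xi>, restr h (bvars \<xi>)) | \<xi> h. \<xi> \<in> \<Sigma> \<and> is_tgd \<xi> \<and> is_trigger I \<xi> h \<and> active I \<xi> h}"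

definition parallel_ext :: "('r,'c) dep set \<Rightarrow> ('r,'c) atom set \<Rightarrow>
    (('r,'c) dep \<times> (nat \<Rightarrow> 'c trm option) \<Rightarrow> nat \<Rightarrow> 'c trm) \<Rightarrow> bool" where
  "parallel_ext \<Sigma> I ext \<longleftrightarrow>
     (\<forall>k\<in>active_keys \<Sigma> I. (\<forall>v\<in>bvars (fst k). snd k v = Some (ext k v)) \<and>
        fresh_ext I (fst k) (ext k) (ext k))
     \<and> (\<forall>k\<in>active_keys \<Sigma> I. \<forall>k'\<in>active_keys \<Sigma> I.
          k \<noteq> k' \<longrightarrow> ext k ` evars (fst k) \<inter> ext k' ` evars (fst k') = {})"

lemma parallel_iff:
  "parallel \<Sigma> I J \<longleftrightarrow>
    (\<exists>ext. parallel_ext \<Sigma> I ext \<and> J = I \<union> (\<Union>k\<in>active_keys \<Sigma> I. inst (ext k) (heads (fst k))))"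
  unfolding parallel_def Let_def active_keys_def[symmetric] parallel_ext_def
  by (simp add: conj_assoc)

lemma finite_active_keys:
  assumes "finite \<Sigma>" "finite I"
  shows "finite (active_keys \<Sigma> I)"
proof (rule finite_subset)
  show "active_keys \<Sigma> I \<subseteq> {(\<xi>, restr h (bvars \<xi>)) | \<xi> h. \<xi> \<in> \<Sigma> \<and> is_trigger I \<xi> h}"
    by (auto simp: active_keys_def)
  show "finite {(\<xi>, restr h (bvars \<xi>)) | \<xi> h. \<xi> \<in> \<Sigma> \<and> is_trigger I \<xi> h}"
    by (rule finite_trigger_keys[OF assms]) simp
qed

lemma finite_parallel: "finite \<Sigma> \<Longrightarrow> finite I \<Longrightarrow> parallel \<Sigma> I J \<Longrightarrow> finite J"
  unfolding parallel_iff by (auto intro: finite_active_keys finite_inst)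

lemma subset_parallel: "parallel \<Sigma> I J \<Longrightarrow> I \<subseteq> J"
  unfolding parallel_iff by blast

lemma parallel_ext_eq: "parallel_ext \<Sigma> I ext \<Longrightarrow> (\<xi>, restr h (bvars \<xi>)) \<in> active_keys \<Sigma> I \<Longrightarrow>
    v \<in> bvars \<xi> \<Longrightarrow> ext (\<xi>, restr h (bvars \<xi>)) v = h v"
  by (fastforce simp: parallel_ext_def restr_def)

lemma parallel_ext_trigger:
  assumes "parallel_ext \<Sigma> I ext" "k \<in> active_keys \<Sigma> I"
  shows "fst k \<in> \<Sigma>" "is_tgd (fst k)" "is_trigger I (fst k) (ext k)"
proof -
  obtain \<xi> h where key: "k = (\<xi>, restr h (bvars \<xi>))" "\<xi> \<in> \<Sigma>" "is_tgd \<xi>" "is_trigger I \<xi> h"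
    using assms(2) by (auto simp: active_keys_def)
  have "inst (ext k) (body \<xi>) = inst h (body \<xi>)"
    using parallel_ext_eq[OF assms(1) assms(2)[unfolded key(1)]] key(1)
    by (intro inst_cong) (simp add: bvars_def)
  then show "fst k \<in> \<Sigma>" "is_tgd (fst k)" "is_trigger I (fst k) (ext k)"
    using key by (simp_all add: is_trigger_def)
qed

lemma rels_of_parallel:
  assumes "parallel \<Sigma> I J"
  shows "fst ` J \<subseteq> fst ` I \<union> rels_of \<Sigma>"
proof -
  obtain ext where ext: "parallel_ext \<Sigma> I ext"
    and J_eq: "J = I \<union> (\<Union>k\<in>active_keys \<Sigma> I. inst (ext k) (heads (fst k)))"
    using assms unfolding parallel_iff by blast
  have "fst ` inst (ext k) (heads (fst k)) \<subseteq> rels_of \<Sigma>" if "k \<in> active_keys \<Sigma> I" for k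
    using parallel_ext_trigger(1)[OF ext that] unfolding fst_inst by (force simp: rels_of_def)
  then show ?thesis
    unfolding J_eq image_Un image_UN by blast
qed

lemma parallel_ext_fresh:
  "parallel_ext \<Sigma> I ext \<Longrightarrow> k \<in> active_keys \<Sigma> I \<Longrightarrow> v \<in> evars (fst k) \<Longrightarrow> ext k v \<notin> terms_over I"
  unfolding parallel_ext_def by (blast dest: fresh_ext_not_in_terms_over)

definition fresh_vars :: "('r,'c) dep set \<Rightarrow> ('r,'c) atom set \<Rightarrow>
    ((('r,'c) dep \<times> (nat \<Rightarrow> 'c trm option)) \<times> nat) set" where
  "fresh_vars \<Sigma> I = (SIGMA k:active_keys \<Sigma> I. evars (fst k))"

lemma finite_fresh_vars: "finite \<Sigma> \<Longrightarrow> finite I \<Longrightarrow> finite (fresh_vars \<Sigma> I)"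
  using finite_active_keys finite_evars unfolding fresh_vars_def by blast

lemma inj_on_parallel_ext:
  assumes "parallel_ext \<Sigma> I ext"
  shows "inj_on (case_prod ext) (fresh_vars \<Sigma> I)"
proof (rule inj_onI)
  fix p p' assume mem: "p \<in> fresh_vars \<Sigma> I" and mem': "p' \<in> fresh_vars \<Sigma> I"
    and eq: "case_prod ext p = case_prod ext p'"
  obtain k v k' v' where pairs: "p = (k, v)" "p' = (k', v')"
    by (cases p; cases p')
  have active: "k \<in> active_keys \<Sigma> I" "k' \<in> active_keys \<Sigma> I"
    and fresh: "v \<in> evars (fst k)" "v' \<in> evars (fst k')"
    using mem mem' unfolding pairs fresh_vars_def by simp_all
  have "ext k v \<in> ext k ` evars (fst k) \<inter> ext k' ` evars (fst k')"
    using imageI[OF fresh(1), of "ext k"] imageI[OF fresh(2), of "ext k'"] eq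
    unfolding pairs by simp
  then have "k = k'"
    using assms active unfolding parallel_ext_def by blast
  moreover have "inj_on (ext k) (evars (fst k))"
    using assms active(1) unfolding parallel_ext_def fresh_ext_def by blast
  ultimately show "p = p'"
    using fresh eq unfolding pairs by (auto dest: inj_onD)
qed

lemma redirect_parallel_ext_old:
  assumes "parallel_ext \<Sigma> I ext" "t \<in> terms_over I"
  shows "redirect (fresh_vars \<Sigma> I) (case_prod ext) w g t = g t"
  using assms parallel_ext_fresh[OF assms(1)] by (intro redirect_other) (auto simp: fresh_vars_def)

lemma redirect_parallel_ext_head:
  assumes ext: "parallel_ext \<Sigma> I ext" and active: "k \<in> active_keys \<Sigma> I"
    and w_bvars: "\<And>v. v \<in> bvars (fst k) \<Longrightarrow> w k v = g (ext k v)"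
    and head_var: "v \<in> avars (heads (fst k))"
  shows "redirect (fresh_vars \<Sigma> I) (case_prod ext) (case_prod w) g (ext k v) = w k v"
proof (cases "v \<in> bvars (fst k)")
  case True
  then have "ext k v \<in> terms_over I"
    using trigger_in_terms_over[OF parallel_ext_trigger(3)[OF ext active]] by blast
  then show ?thesis
    using w_bvars[OF True] by (simp add: redirect_parallel_ext_old[OF ext])
next
  case False
  then have "(k, v) \<in> fresh_vars \<Sigma> I"
    using head_var active avars_heads_subset[of "fst k"] by (auto simp: fresh_vars_def)
  then show ?thesis
    using redirect_image[OF inj_on_parallel_ext[OF ext], of "(k, v)" "case_prod w" g] by simp
qed

lemma parallel_exists:
  fixes \<Sigma> :: "('r,'c) dep set"
  assumes "finite \<Sigma>" "finite I"
  shows "\<exists>J. parallel \<Sigma> I J"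
proof -
  obtain u :: "_ \<Rightarrow> 'c trm" where inj: "inj_on u (fresh_vars \<Sigma> I)"
    and fresh: "\<forall>p\<in>fresh_vars \<Sigma> I. \<exists>n. u p = Nul n \<and> n \<notin> nulls_of I"
    using fresh_nulls_exist[OF finite_fresh_vars[OF assms] assms(2)] by blast
  define ext where "ext k v = (if v \<in> bvars (fst k) then the (snd k v) else u (k, v))"
    for k :: "('r,'c) dep \<times> (nat \<Rightarrow> 'c trm option)" and v
  have ext_evars: "ext k v = u (k, v)" if "v \<in> evars (fst k)" for k v
    using that by (simp add: ext_def evars_def bvars_def)
  have "parallel_ext \<Sigma> I ext"
    unfolding parallel_ext_def
  proof (intro conjI ballI impI)
    fix k v assume "k \<in> active_keys \<Sigma> I" "v \<in> bvars (fst k)"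
    then show "snd k v = Some (ext k v)"
      by (auto simp: active_keys_def ext_def restr_def)
  next
    fix k assume active: "k \<in> active_keys \<Sigma> I"
    have "inj_on (ext k) (evars (fst k))"
      using inj active by (auto simp: inj_on_def ext_evars fresh_vars_def)
    then show "fresh_ext I (fst k) (ext k) (ext k)"
      using fresh active by (simp add: fresh_ext_def ext_evars fresh_vars_def)
  next
    fix k k' assume "k \<in> active_keys \<Sigma> I" "k' \<in> active_keys \<Sigma> I" "k \<noteq> k'"
    then show "ext k ` evars (fst k) \<inter> ext k' ` evars (fst k') = {}"
      using inj by (auto simp: inj_on_def ext_evars fresh_vars_def)
  qed
  then show ?thesis unfolding parallel_iff by blast
qed

lemma parallel_head_satisfied:
  assumes par: "parallel \<Sigma> I J" and \<xi>: "\<xi> \<in> \<Sigma>" "is_tgd \<xi>" and trigger: "is_trigger I \<xi> h"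
  shows "head_satisfied J \<xi> h"
proof (cases "active I \<xi> h")
  case False
  then show ?thesis
    using \<xi>(2) subset_parallel[OF par] head_satisfied_mono
    by (auto simp: active_iff_not_head_satisfied)
next
  case True
  obtain ext where ext: "parallel_ext \<Sigma> I ext"
    and J_eq: "J = I \<union> (\<Union>k\<in>active_keys \<Sigma> I. inst (ext k) (heads (fst k)))"
    using par unfolding parallel_iff by blast
  let ?k = "(\<xi>, restr h (bvars \<xi>))"
  have active: "?k \<in> active_keys \<Sigma> I"
    using True \<xi> trigger by (auto simp: active_keys_def)
  then have "\<forall>v\<in>bvars \<xi>. ext ?k v = h v"
    using parallel_ext_eq[OF ext] by blast
  moreover have "inst (ext ?k) (heads \<xi>) \<subseteq> J"
    using J_eq active by force
  ultimately show ?thesis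
    unfolding head_satisfied_def by blast
qed

lemma parallel_hom:
  assumes par: "parallel \<Sigma> I J" and hom: "hom g I M"
    and sat: "\<And>\<xi> h. \<xi> \<in> \<Sigma> \<Longrightarrow> is_tgd \<xi> \<Longrightarrow> is_trigger I \<xi> h \<Longrightarrow> head_satisfied M \<xi> (g \<circ> h)"
  shows "\<exists>g'. hom g' J M"
proof -
  let ?K = "active_keys \<Sigma> I"
  obtain ext where ext: "parallel_ext \<Sigma> I ext"
    and J_eq: "J = I \<union> (\<Union>k\<in>?K. inst (ext k) (heads (fst k)))"
    using par unfolding parallel_iff by blast
  have "\<forall>k\<in>?K. head_satisfied M (fst k) (g \<circ> ext k)"
    using sat parallel_ext_trigger[OF ext] by blast
  then obtain w where w_bvars: "\<And>k v. k \<in> ?K \<Longrightarrow> v \<in> bvars (fst k) \<Longrightarrow> w k v = g (ext k v)"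
    and head: "\<And>k. k \<in> ?K \<Longrightarrow> inst (w k) (heads (fst k)) \<subseteq> M"
    unfolding head_satisfied_def comp_def by metis
  define g' where "g' = redirect (fresh_vars \<Sigma> I) (case_prod ext) (case_prod w) g"
  have old: "g' t = g t" if "t \<in> terms_over I" for t
    unfolding g'_def using ext that by (rule redirect_parallel_ext_old)
  have g'_Cst: "g' (Cst c) = Cst c" for c
    using old hom_Cst[OF hom] by simp
  have "map_instance g' I = map_instance g I"
    using old by (intro map_instance_cong) (simp add: terms_over_def)
  then have "map_instance g' I \<subseteq> M"
    using hom by (simp add: hom_iff_map_instance)
  moreover have "map_instance g' (inst (ext k) (heads (fst k))) \<subseteq> M" if active: "k \<in> ?K" for k
  proof -
    have "map_instance g' (inst (ext k) (heads (fst k))) = inst (g' \<circ> ext k) (heads (fst k))"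
      using g'_Cst by (rule inst_comp[symmetric])
    also have "\<dots> = inst (w k) (heads (fst k))"
      using redirect_parallel_ext_head[OF ext active, of w g] w_bvars[OF active]
      by (intro inst_cong) (simp add: g'_def)
    finally show ?thesis
      using head[OF active] by simp
  qed
  ultimately have "map_instance g' J \<subseteq> M"
    unfolding J_eq map_instance_Un map_instance_UN by blast
  then show ?thesis
    using g'_Cst by (auto simp: hom_iff_map_instance)
qed

section \<open>Cores\<close>

lemma core_subset: "is_core_of J C \<Longrightarrow> C \<subseteq> J"
  and core_retraction: "is_core_of J C \<Longrightarrow> \<exists>f. hom f J C"
  by (auto simp: is_core_of_def)

lemma core_exists:
  assumes "finite J"
  shows "\<exists>C. is_core_of J C"
proof -
  let ?P = "\<lambda>C. C \<subseteq> J \<and> (\<exists>f. hom f J C)"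
  obtain C where retract: "?P C" and minimal: "\<And>C'. ?P C' \<Longrightarrow> card C \<le> card C'"
    using ex_has_least_nat[of ?P J card] hom_id[of J J] by blast
  have "\<not> (C' \<subset> C \<and> hom f C C')" for C' f
  proof
    assume smaller: "C' \<subset> C \<and> hom f C C'"
    then have "?P C'"
      using retract hom_comp by blast
    then have "card C \<le> card C'"
      by (rule minimal)
    moreover have "card C' < card C"
      using smaller retract assms by (meson finite_subset psubset_card_mono)
    ultimately show False by simp
  qed
  then show ?thesis using retract unfolding is_core_of_def by blast
qed

lemma core_endomorphism_inverse:
  assumes core: "is_core_of J C" and fin: "finite C" and endo: "hom f C C"
  shows "\<exists>g. hom g C C \<and> (\<forall>t\<in>adom C. g (f t) = t)"
proof -
  have map_f: "map_instance f C = C"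
  proof -
    have "map_instance f C \<subseteq> C" "hom f C (map_instance f C)"
      using endo by (simp_all add: hom_iff_map_instance)
    then show ?thesis
      using core unfolding is_core_of_def by blast
  qed
  have surj: "f ` adom C = adom C"
    using adom_map_instance[of f C] map_f by simp
  then have inj: "inj_on f (adom C)"
    using finite_adom[OF fin] by (simp add: eq_card_imp_inj_on)
  define g where "g t = (if t \<in> adom C then inv_into (adom C) f t else t)" for t
  have g_f: "g (f t) = t" if "t \<in> adom C" for t
    using that inj surj by (auto simp: g_def)
  have "g (Cst c) = Cst c" for c
    using g_f[of "Cst c"] hom_Cst[OF endo] by (simp add: g_def)
  moreover have "map_instance g C = C"
  proof -
    have "map_instance g C = map_instance (g \<circ> f) C"
      using map_instance_comp[of g f C] map_f by simp
    also have "\<dots> = C"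
      using g_f by (intro map_instance_ident) simp
    finally show ?thesis .
  qed
  ultimately have "hom g C C"
    by (simp add: hom_iff_map_instance)
  then show ?thesis using g_f by blast
qed

section \<open>Models\<close>

definition model :: "('r,'c) dep set \<Rightarrow> ('r,'c) atom set \<Rightarrow> bool" where
  "model \<Sigma> M \<longleftrightarrow> (\<forall>\<xi>\<in>\<Sigma>. \<forall>h. is_trigger M \<xi> h \<longrightarrow> \<not> active M \<xi> h)"

lemma model_tgd: "model \<Sigma> M \<Longrightarrow> \<xi> \<in> \<Sigma> \<Longrightarrow> is_tgd \<xi> \<Longrightarrow> is_trigger M \<xi> h \<Longrightarrow> head_satisfied M \<xi> h"
  unfolding model_def using active_iff_not_head_satisfied by blast

lemma model_egd: "model \<Sigma> M \<Longrightarrow> EGD b x y \<in> \<Sigma> \<Longrightarrow> is_trigger M (EGD b x y) h \<Longrightarrow> h x = h y"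
  unfolding model_def by fastforce

lemma modelI:
  assumes "\<And>\<xi> h. \<xi> \<in> \<Sigma> \<Longrightarrow> is_tgd \<xi> \<Longrightarrow> is_trigger M \<xi> h \<Longrightarrow> head_satisfied M \<xi> h"
    and "\<And>b x y h. EGD b x y \<in> \<Sigma> \<Longrightarrow> is_trigger M (EGD b x y) h \<Longrightarrow> h x = h y"
  shows "model \<Sigma> M"
  unfolding model_def
proof (intro ballI allI impI)
  fix \<xi> h assume \<xi>: "\<xi> \<in> \<Sigma>" and trigger: "is_trigger M \<xi> h"
  show "\<not> active M \<xi> h"
  proof (cases "is_tgd \<xi>")
    case True
    then show ?thesis
      using assms(1)[OF \<xi> _ trigger] by (simp add: active_iff_not_head_satisfied)
  next
    case False
    then show ?thesis
      using assms(2) \<xi> trigger by (cases \<xi>) auto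
  qed
qed

lemma model_retract:
  assumes wf: "\<And>\<xi>. \<xi> \<in> \<Sigma> \<Longrightarrow> wf_dep ar \<xi>" and model: "model \<Sigma> M"
    and embedding: "hom f A M" and retraction: "hom g M A" "\<And>t. t \<in> adom A \<Longrightarrow> g (f t) = t"
  shows "model \<Sigma> A"
proof (rule modelI)
  fix \<xi> h assume \<xi>: "\<xi> \<in> \<Sigma>" "is_tgd \<xi>" and trigger: "is_trigger A \<xi> h"
  have "head_satisfied A \<xi> (g \<circ> (f \<circ> h))"
    by (rule head_satisfied_hom[OF retraction(1)
          model_tgd[OF model \<xi> is_trigger_hom[OF embedding trigger]]])
  moreover have "(g \<circ> (f \<circ> h)) v = h v" if "v \<in> bvars \<xi>" for v
    using trigger_in_adom[OF trigger that] retraction(2) by simp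
  ultimately show "head_satisfied A \<xi> h"
    using head_satisfied_cong by metis
next
  fix b x y h assume egd: "EGD b x y \<in> \<Sigma>" and trigger: "is_trigger A (EGD b x y) h"
  have "f (h x) = f (h y)"
    using model_egd[OF model egd is_trigger_hom[OF embedding trigger]] by simp
  moreover have "h x \<in> adom A" "h y \<in> adom A"
    using trigger_in_adom[OF trigger] wf_dep_egd_vars[OF wf[OF egd]] by (simp_all add: bvars_def)
  ultimately show "h x = h y"
    using retraction(2) by metis
qed

lemma model_core:
  assumes "\<And>\<xi>. \<xi> \<in> \<Sigma> \<Longrightarrow> wf_dep ar \<xi>" and core: "is_core_of J C" "finite C"
    and "model \<Sigma> M" and homs: "hom f C M" "hom g M C"
  shows "model \<Sigma> C"
proof -
  obtain k where inverse: "hom k C C" "\<forall>t\<in>adom C. k ((g \<circ> f) t) = t"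
    using core_endomorphism_inverse[OF core hom_comp[OF homs]] by blast
  show ?thesis
    using assms(1) \<open>model \<Sigma> M\<close> homs(1) hom_comp[OF homs(2) inverse(1)]
    by (rule model_retract) (use inverse(2) in simp_all)
qed

context dependencies
begin

lemma model_saturated:
  assumes "model \<Sigma>t J"
  shows "saturated E ar (rels_of \<Sigma>) J"
proof (rule ccontr)
  assume "\<not> saturated E ar (rels_of \<Sigma>) J"
  then obtain R us i t h where rule_in: "R \<in> rels_of \<Sigma>" "i < ar R"
    and trigger: "is_trigger J (repl_rule E R (ar R) i) h"
    and head: "inst h (heads (repl_rule E R (ar R) i)) = {(R, us[i := t])}"
    and unsat: "(R, us[i := t]) \<notin> J"
    by (rule unsaturated_repl_rule)
  have "inst h (heads (repl_rule E R (ar R) i)) \<subseteq> J"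
    using model_tgd[OF assms sigma_tgd_repl[where ar = ar, OF rule_in] is_tgd_repl_rule trigger]
    by (simp add: head_satisfied_full_iff evars_repl_rule)
  then show False
    using head unsat by simp
qed

end

lemma (in dependencies_quotient) quotient_model:
  assumes model: "model \<Sigma>t J"
  shows "model \<Sigma> I"
proof (rule modelI)
  fix \<xi> h assume \<xi>: "\<xi> \<in> \<Sigma>" "is_tgd \<xi>" and trigger: "is_trigger I \<xi> h"
  have "head_satisfied J \<xi> (e \<circ> h)"
    by (rule model_tgd[OF model sigma_tgd_tgd[OF \<xi>] \<xi>(2)
          lift_trigger[OF model_saturated[OF model] \<xi>(1) trigger]])
  then show "head_satisfied I \<xi> h"
    by (rule project_head_satisfied[OF \<xi>(1) trigger])
next
  fix b x y h assume egd: "EGD b x y \<in> \<Sigma>" and trigger: "is_trigger I (EGD b x y) h"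
  have "is_trigger J (egd_tgd E b x y) (e \<circ> h)"
    using lift_trigger[OF model_saturated[OF model] egd trigger] by simp
  then have "head_satisfied J (egd_tgd E b x y) (e \<circ> h)"
    using model_tgd[OF model sigma_tgd_egd[OF egd]] by simp
  then have "(e (h x), e (h y)) \<in> Erel E J"
    using head_satisfied_full_iff[OF evars_egd_tgd[OF egd_vars[OF egd]]] by (simp add: Erel_def)
  then have "q (e (h x)) = q (e (h y))"
    by (rule q_Erel)
  moreover have "h x \<in> terms_over I" "h y \<in> terms_over I"
    using trigger_in_terms_over[OF trigger] egd_vars[OF egd] by (auto simp: bvars_def)
  ultimately show "h x = h y"
    using q_e by simp
qed

section \<open>The core chase\<close>

lemma core_step_cases:
  assumes "step CoreV \<Sigma> (Inst X, H) (Inst X', H')"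
  obtains (merge) b x y h n w where "EGD b x y \<in> \<Sigma>" "is_trigger X (EGD b x y) h"
      "{Nul n, w} = {h x, h y}" "w \<noteq> Nul n" "X' = replace (Nul n) w X"
    | (parallel) P where "model {\<xi> \<in> \<Sigma>. \<not> is_tgd \<xi>} X" "parallel \<Sigma> X P" "is_core_of P X'"
proof -
  consider (egd) \<xi> h where "\<xi> \<in> \<Sigma>" "\<not> is_tgd \<xi>" "is_trigger X \<xi> h" "active X \<xi> h"
      "fire X \<xi> h (Inst X')"
    | (tgd) P where "\<not> (\<exists>\<xi>\<in>\<Sigma>. \<exists>h. \<not> is_tgd \<xi> \<and> is_trigger X \<xi> h \<and> active X \<xi> h)"
      "parallel \<Sigma> X P" "is_core_of P X'"
    using assms unfolding step.simps st.inject by blast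
  then show thesis
  proof cases
    case egd
    then obtain b x y where \<xi>: "\<xi> = EGD b x y" by (cases \<xi>) auto
    then have "h x \<noteq> h y" "Inst X' = egd_result X (h x) (h y)" using egd by auto
    then show thesis
      using merge egd \<xi> by (cases rule: egd_result_cases[of "h x" "h y" X]) auto
  next
    case tgd
    then have "model {\<xi> \<in> \<Sigma>. \<not> is_tgd \<xi>} X"
      unfolding model_def by blast
    then show thesis using parallel tgd by blast
  qed
qed

lemma core_step_exists:
  assumes "finite \<Sigma>" "finite X" "\<And>\<xi>. \<xi> \<in> \<Sigma> \<Longrightarrow> is_tgd \<xi>" "\<not> model \<Sigma> X"
  shows "\<exists>X'. step CoreV \<Sigma> (Inst X, H) (Inst X', H)"
proof -
  obtain P where par: "parallel \<Sigma> X P"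
    using parallel_exists[OF assms(1,2)] by blast
  obtain C where "is_core_of P C"
    using core_exists[OF finite_parallel[OF assms(1,2) par]] by blast
  then show ?thesis
    using par assms(3,4) unfolding model_def step.simps by blast
qed

lemma core_step_not_model: "step CoreV \<Sigma> (Inst X, H) S \<Longrightarrow> \<not> model \<Sigma> X"
  by (cases S) (auto simp: model_def)

lemma core_step_hom:
  assumes "step CoreV \<Sigma> (Inst X, H) (Inst X', H')"
  shows "\<exists>f. hom f X X'"
  using assms
proof (cases rule: core_step_cases)
  case (merge b x y h n w)
  then have "hom (id(Nul n := w)) X X'"
    by (simp add: hom_iff_map_instance replace_eq_map_instance)
  then show ?thesis by blast
next
  case (parallel P)
  then show ?thesis
    using core_retraction hom_subset[OF _ subset_parallel order.refl] by blast
qed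

lemma core_step_finite:
  assumes "finite \<Sigma>" "finite X" and "step CoreV \<Sigma> (Inst X, H) (Inst X', H')"
  shows "finite X'"
  using assms(3)
proof (cases rule: core_step_cases)
  case merge
  then show ?thesis using assms(2) by (simp add: replace_def)
next
  case (parallel P)
  then show ?thesis
    using core_subset finite_parallel[OF assms(1,2)] finite_subset by blast
qed

lemma core_step_rels:
  assumes "step CoreV \<Sigma> (Inst X, H) (Inst X', H')"
  shows "fst ` X' \<subseteq> fst ` X \<union> rels_of \<Sigma>"
  using assms
proof (cases rule: core_step_cases)
  case merge
  then show ?thesis by (simp add: replace_eq_map_instance fst_map_instance)
next
  case (parallel P)
  then show ?thesis
    using core_subset[OF parallel(3)] rels_of_parallel[OF parallel(2)] by blast
qed

lemma core_step_hom_model: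
  assumes "step CoreV \<Sigma> (Inst X, H) (Inst X', H')" and hom: "hom g X M" and model: "model \<Sigma> M"
  shows "\<exists>g'. hom g' X' M"
  using assms(1)
proof (cases rule: core_step_cases)
  case (merge b x y h n w)
  have "g (h x) = g (h y)"
    using model_egd[OF model merge(1) is_trigger_hom[OF hom merge(2)]] by simp
  then have "g (Nul n) = g w"
    using merge(3) by (auto simp: doubleton_eq_iff)
  then have "g \<circ> id(Nul n := w) = g"
    by auto
  then show ?thesis
    using hom map_instance_comp[of g "id(Nul n := w)" X] merge(5)
    by (auto simp: hom_iff_map_instance replace_eq_map_instance)
next
  case (parallel P)
  have "head_satisfied M \<xi> (g \<circ> h)" if "\<xi> \<in> \<Sigma>" "is_tgd \<xi>" "is_trigger X \<xi> h" for \<xi> h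
    using model_tgd[OF model that(1,2) is_trigger_hom[OF hom that(3)]] .
  then show ?thesis
    using parallel_hom[OF parallel(2) hom] hom_subset[OF _ core_subset[OF parallel(3)] order.refl]
    by blast
qed

lemma card_nulls_of_replace_less:
  assumes "finite X" "Nul n \<in> adom X" "w \<in> adom X" "w \<noteq> Nul n"
  shows "card (nulls_of (replace (Nul n) w X)) < card (nulls_of X)"
proof (rule psubset_card_mono[OF finite_nulls_of[OF assms(1)]])
  have "adom (replace (Nul n) w X) \<subseteq> adom X - {Nul n}"
    using assms(3,4) by (auto simp: replace_eq_map_instance adom_map_instance)
  then have "nulls_of (replace (Nul n) w X) \<subseteq> nulls_of X - {n}"
    by (auto simp: nulls_of_iff_adom)
  moreover have "n \<in> nulls_of X"
    using assms(2) by (simp add: nulls_of_iff_adom)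
  ultimately show "nulls_of (replace (Nul n) w X) \<subset> nulls_of X"
    by blast
qed

lemma terminating_core_chase_reaches_model:
  assumes "terminating CoreV \<Sigma> (Inst J, {})"
    and \<Sigma>: "finite \<Sigma>" "\<And>\<xi>. \<xi> \<in> \<Sigma> \<Longrightarrow> is_tgd \<xi>" and "finite J" "P J"
    and invariant: "\<And>J J'. P J \<Longrightarrow> step CoreV \<Sigma> (Inst J, {}) (Inst J', {}) \<Longrightarrow> P J'"
  shows "\<exists>M. model \<Sigma> M \<and> P M"
  using assms(1) \<open>finite J\<close> \<open>P J\<close>
proof (induction "(Inst J, {}) :: ('a, 'b) config" arbitrary: J rule: accp.induct)
  case accI
  show ?case
  proof (cases "model \<Sigma> J")
    case True
    then show ?thesis using accI.prems by blast
  next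
    case False
    then obtain J' where step: "step CoreV \<Sigma> (Inst J, {}) (Inst J', {})"
      using core_step_exists[OF \<Sigma>(1) accI.prems(1) \<Sigma>(2)] by blast
    show ?thesis
      by (rule accI.hyps(2)[OF step core_step_finite[OF \<Sigma>(1) accI.prems(1) step]
            invariant[OF accI.prems(2) step]])
  qed
qed

lemma infinite_core_chase_instances:
  assumes start: "f 0 = (Inst I, {})" and step: "\<And>n. step CoreV \<Sigma> (f n) (f (Suc n))"
  obtains X where "\<And>n. f n = (Inst (X n), {})" "X 0 = I"
proof -
  have "\<exists>Y. f n = (Inst Y, {})" for n
  proof (induction n)
    case 0
    then show ?case using start by blast
  next
    case (Suc n)
    then obtain Y S H where "f n = (Inst Y, {})" and next_config: "f (Suc n) = (S, H)"
      by (metis prod.exhaust)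
    then have "H = {}"
      using step[of n] by simp
    moreover have "S \<noteq> Fail"
      using step[of "Suc n"] next_config by auto
    ultimately show ?case
      using next_config by (cases S) auto
  qed
  then obtain X where "\<And>n. f n = (Inst (X n), {})"
    by metis
  then show thesis using that start by simp
qed

definition diag :: "'r \<Rightarrow> ('r,'c) atom set" where
  "diag E = {(E, [t, t]) | t. True}"

lemma hom_Un_diag: "hom f A B \<Longrightarrow> hom f (A \<union> diag E) (B \<union> diag E)"
  by (auto simp: hom_def diag_def)

lemma reduct_Un_diag: "E \<notin> fst ` X \<Longrightarrow> reduct E (X \<union> diag E) = X"
  by (auto simp: reduct_Un reduct_ident) (simp add: reduct_def diag_def)

lemma Erel_Un_diag: "E \<notin> fst ` X \<Longrightarrow> Erel E (X \<union> diag E) = Id"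
  by (force simp: Erel_def diag_def)

lemma hom_Erel: "hom g A B \<Longrightarrow> (s, t) \<in> Erel E A \<Longrightarrow> (g s, g t) \<in> Erel E B"
  using hom_atom[of g A B E] by (fastforce simp: Erel_def)

context dependencies
begin

lemma diag_head_satisfied:
  assumes par: "parallel \<Sigma> X P" and egds: "model {\<xi> \<in> \<Sigma>. \<not> is_tgd \<xi>} X"
    and E_free: "E \<notin> fst ` X" and \<xi>: "\<xi> \<in> \<Sigma>t" and trigger: "is_trigger (X \<union> diag E) \<xi> h"
  shows "head_satisfied (P \<union> diag E) \<xi> h"
proof -
  have without_diag: "is_trigger X \<zeta> h" if "\<zeta> \<in> \<Sigma>" "is_trigger (X \<union> diag E) \<zeta> h" for \<zeta>
    using that inst_subset_reduct_iff[OF body_not_E[OF that(1)], of h "X \<union> diag E"]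
    by (simp add: is_trigger_def reduct_Un_diag[OF E_free])
  show ?thesis
    using \<xi>
  proof (cases rule: sigma_tgd_cases)
    case tgd
    then have "head_satisfied P \<xi> h"
      using without_diag trigger by (intro parallel_head_satisfied[OF par])
    then show ?thesis by (rule head_satisfied_mono) simp
  next
    case (egd b x y)
    have "h x = h y"
      using model_egd[OF egds] without_diag[OF egd(1)] egd trigger by simp
    then show ?thesis
      using head_satisfied_full_iff[OF evars_egd_tgd[OF egd_vars[OF egd(1)]]] egd(2)
      by (simp add: diag_def)
  next
    case (repl R i)
    have "(E, [h (ar R), h (Suc (ar R))]) \<in> X \<union> diag E"
      using trigger repl(3) by (simp add: is_trigger_def repl_rule_def inst_def)
    then have "h (ar R) = h (Suc (ar R))"
      using E_free by (force simp: diag_def)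
    then have "inst h (heads \<xi>) \<subseteq> X \<union> diag E"
      using inst_heads_repl_rule_diagonal[of h "ar R" E R i] trigger
      unfolding repl(3) is_trigger_def by blast
    then have "inst h (heads \<xi>) \<subseteq> P \<union> diag E"
      using subset_parallel[OF par] by blast
    then show ?thesis
      by (simp add: repl(3) head_satisfied_full_iff evars_repl_rule)
  qed
qed

lemma quotient_model_exists:
  assumes model: "model \<Sigma>t J" and from_start: "hom f A J" "E \<notin> fst ` A"
    and to_stage: "hom g J (X \<union> diag E)" "E \<notin> fst ` X"
  shows "\<exists>Q f' g'. model \<Sigma> Q \<and> hom f' A Q \<and> hom g' Q X"
proof -
  have g_Erel: "g s = g t" if "(s, t) \<in> Erel E J" for s t
    using hom_Erel[OF to_stage(1) that] Erel_Un_diag[OF to_stage(2)] by simp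
  have "g s = g t" if "(s, t) \<in> (Erel E J)\<^sup>*" for s t
    using that by (induction rule: rtrancl_induct) (simp_all add: g_Erel)
  then have "c = d" if "(Cst c, Cst d) \<in> (Erel E J)\<^sup>*" for c d
    using that hom_Cst[OF to_stage(1)] by fastforce
  then have "\<exists>Q q e. E_quotient E J Q q e"
    by (rule E_quotient_exists)
  then obtain Q q e where "E_quotient E J Q q e"
    by blast
  then interpret dependencies_quotient \<Sigma> ar E J Q q e
    by (intro dependencies_quotient.intro dependencies_axioms)
  have "hom f A (reduct E J)"
    using hom_reduct[OF from_start(1), of E] reduct_ident[OF from_start(2)] by simp
  then have "hom (q \<circ> f) A Q"
    using hom_q by (rule hom_comp)
  moreover have "hom (g \<circ> e) Q X"
    using hom_reduct[OF to_stage(1), of E] g_Erel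
    by (intro hom_factor) (simp_all add: reduct_Un_diag[OF to_stage(2)])
  ultimately show ?thesis
    using quotient_model[OF model] by blast
qed

end

locale infinite_core_chase = dependencies \<Sigma> ar E
  for \<Sigma> :: "('r,'c) dep set" and ar :: "'r \<Rightarrow> nat" and E :: 'r +
  fixes X :: "nat \<Rightarrow> ('r,'c) atom set"
  assumes finite_start: "finite (X 0)"
    and E_notin_start: "E \<notin> fst ` X 0"
    and core_step: "step CoreV \<Sigma> (Inst (X n), {}) (Inst (X (Suc n)), {})"
begin

lemma finite_stage: "finite (X n)"
proof (induction n)
  case 0
  then show ?case by (rule finite_start)
next
  case (Suc n)
  then show ?case by (rule core_step_finite[OF finite_\<Sigma> _ core_step])
qed

lemma E_notin_stage: "E \<notin> fst ` X n"
proof (induction n)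
  case 0
  then show ?case by (rule E_notin_start)
next
  case (Suc n)
  then show ?case using core_step_rels[OF core_step] E_new by blast
qed

lemma hom_stages:
  assumes "i \<le> j"
  shows "\<exists>f. hom f (X i) (X j)"
  using assms
proof (induction j rule: dec_induct)
  case base
  then show ?case using hom_id by blast
next
  case (step j)
  then show ?case using core_step_hom[OF core_step] hom_comp by blast
qed

lemma hom_stage_model:
  assumes "hom f (X 0) M" "model \<Sigma> M"
  shows "\<exists>g. hom g (X n) M"
proof (induction n)
  case 0
  then show ?case using assms(1) by blast
next
  case (Suc n)
  then show ?case using core_step_hom_model[OF core_step _ assms(2)] by blast
qed

lemma parallel_stage_exists:
  "\<exists>k\<ge>n. \<exists>P. model {\<xi> \<in> \<Sigma>. \<not> is_tgd \<xi>} (X k) \<and> parallel \<Sigma> (X k) P \<and> is_core_of P (X (Suc k))"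
proof (induction "card (nulls_of (X n))" arbitrary: n rule: less_induct)
  case less
  show ?case
    using core_step[of n]
  proof (cases rule: core_step_cases)
    case (merge b x y h m w)
    have "h x \<in> adom (X n)" "h y \<in> adom (X n)"
      using trigger_in_adom[OF merge(2)] egd_vars[OF merge(1)] by (simp_all add: bvars_def)
    then have "Nul m \<in> adom (X n)" "w \<in> adom (X n)"
      using merge(3) by (metis insertCI insertE singletonD)+
    then have "card (nulls_of (X (Suc n))) < card (nulls_of (X n))"
      using card_nulls_of_replace_less[OF finite_stage] merge(4,5) by simp
    from less[OF this] show ?thesis
      by (meson Suc_leD)
  next
    case (parallel P)
    then show ?thesis by blast
  qed
qed

lemma no_model_between_stages:
  assumes model: "model \<Sigma> Q" and from_start: "hom f (X 0) Q" and to_stage: "hom g Q (X n)"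
  shows False
proof -
  obtain k P where later: "n \<le> k" and core: "is_core_of P (X (Suc k))"
    using parallel_stage_exists[of n] by blast
  obtain j where "hom j (X n) (X (Suc k))"
    using hom_stages[of n "Suc k"] later by auto
  then have "hom (j \<circ> g) Q (X (Suc k))"
    by (rule hom_comp[OF to_stage])
  moreover obtain f' where "hom f' (X (Suc k)) Q"
    using hom_stage_model[OF from_start model] by blast
  ultimately have "model \<Sigma> (X (Suc k))"
    using model_core[OF wf core finite_stage model] by blast
  then show False
    using core_step_not_model[OF core_step] by blast
qed

lemma tgd_step_hom_stage:
  assumes step: "step CoreV \<Sigma>t (Inst J, {}) (Inst J', {})" and to_stage: "hom g J (X n \<union> diag E)"
  shows "\<exists>g' n'. hom g' J' (X n' \<union> diag E)"
  using step
proof (cases rule: core_step_cases)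
  case (merge b x y)
  then show ?thesis
    using is_tgd_sigma_tgd by fastforce
next
  case (parallel P')
  obtain k P where later: "n \<le> k" and egds: "model {\<xi> \<in> \<Sigma>. \<not> is_tgd \<xi>} (X k)"
    and par: "parallel \<Sigma> (X k) P" and core: "is_core_of P (X (Suc k))"
    using parallel_stage_exists[of n] by blast
  obtain f where to_next: "hom f (X n) (X k)"
    using hom_stages[OF later] by blast
  let ?g = "f \<circ> g"
  have to_later: "hom ?g J (X k \<union> diag E)"
    by (rule hom_comp[OF to_stage hom_Un_diag[OF to_next]])
  have "X k \<union> diag E \<subseteq> P \<union> diag E"
    using subset_parallel[OF par] by blast
  then have "hom ?g J (P \<union> diag E)"
    by (rule hom_subset[OF to_later order.refl])
  moreover have "head_satisfied (P \<union> diag E) \<xi> (?g \<circ> h)" if "\<xi> \<in> \<Sigma>t" "is_trigger J \<xi> h" for \<xi> h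
    by (rule diag_head_satisfied[OF par egds E_notin_stage that(1)
          is_trigger_hom[OF to_later that(2)]])
  ultimately obtain g' where to_parallel: "hom g' P' (P \<union> diag E)"
    using parallel_hom[OF parallel(2)] by blast
  obtain r where retraction: "hom r P (X (Suc k))"
    using core_retraction[OF core] by blast
  have "hom (r \<circ> g') J' (X (Suc k) \<union> diag E)"
    by (rule hom_comp[OF hom_subset[OF to_parallel core_subset[OF parallel(3)] order.refl]
          hom_Un_diag[OF retraction]])
  then show ?thesis by blast
qed

lemma tgd_chase_not_terminating: "\<not> terminates CoreV \<Sigma>t (X 0)"
proof
  assume "terminates CoreV \<Sigma>t (X 0)"
  then have terminating: "terminating CoreV \<Sigma>t (Inst (X 0), {})"
    by (simp add: terminates_iff_terminating)
  let ?P = "\<lambda>J. (\<exists>f. hom f (X 0) J) \<and> (\<exists>g n. hom g J (X n \<union> diag E))"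
  have "\<exists>M. model \<Sigma>t M \<and> ?P M"
    using terminating finite_sigma_tgd[OF finite_\<Sigma>] is_tgd_sigma_tgd finite_start
  proof (rule terminating_core_chase_reaches_model)
    show "?P (X 0)"
      using hom_id[of "X 0" "X 0"] hom_id[of "X 0" "X 0 \<union> diag E"] by blast
    show "?P J'" if "?P J" "step CoreV \<Sigma>t (Inst J, {}) (Inst J', {})" for J J'
      using that(1) hom_comp core_step_hom[OF that(2)] tgd_step_hom_stage[OF that(2)] by blast
  qed
  then obtain M f g n where "model \<Sigma>t M" "hom f (X 0) M" "hom g M (X n \<union> diag E)"
    by blast
  then show False
    using quotient_model_exists[OF _ _ E_notin_start _ E_notin_stage] no_model_between_stages
    by meson
qed

end

lemma (in dependencies) terminates_core:
  assumes start: "finite I" "E \<notin> fst ` I" and tgd_chase: "terminates CoreV \<Sigma>t I"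
  shows "terminates CoreV \<Sigma> I"
  unfolding terminates_def
proof
  assume "\<exists>f. f 0 = (Inst I, {}) \<and> (\<forall>n. step CoreV \<Sigma> (f n) (f (Suc n)))"
  then obtain f where "f 0 = (Inst I, {})" and steps: "\<And>n. step CoreV \<Sigma> (f n) (f (Suc n))"
    by blast
  then obtain X where stages: "\<And>n. f n = (Inst (X n), {})" "X 0 = I"
    using infinite_core_chase_instances by blast
  interpret infinite_core_chase \<Sigma> ar E X
    using start stages steps by unfold_locales metis+
  show False
    using tgd_chase_not_terminating tgd_chase stages(2) by simp
qed

theorem theorem2:
  fixes \<Sigma> :: "('r,'c) dep set" and I :: "('r,'c) atom set"
    and ar :: "'r \<Rightarrow> nat" and E :: 'r and v :: variant
  assumes "finite \<Sigma>" and "finite I"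
    and "\<forall>\<xi>\<in>\<Sigma>. wf_dep ar \<xi>"
    and "\<forall>(R,ts)\<in>I. length ts = ar R"
    and "E \<notin> rels_of \<Sigma>" and "E \<notin> fst ` I"
    and "terminates v (sigma_tgd E ar \<Sigma>) I"
  shows "terminates v \<Sigma> I"
proof -
  interpret dependencies \<Sigma> ar E
    using assms by unfold_locales auto
  show ?thesis
    using terminates_core terminates_non_core assms by (cases "v = CoreV") auto
qed

end
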